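(* Let $\Lambda$ be any shifted triangular Gatzouras--Lalley-type (TGL) planar carpet (no separation or non-overlapping condition on the cylinders is assumed). Then $$\dim_{\rm H}\Lambda\le \sup_{\mathbf p\in\mathcal P}D(\mathbf p)=:\alpha^\ast .$$ Furthermore, there always exists $\mathbf p^\ast\in\mathcal P_0$ with $D(\mathbf p^\ast)=\alpha^\ast$.
   Context: Shifted TGL carpet: for $i\in[N]=\{1,\dots,N\}$ let $f_i(\underline x)=A_i\underline x+t_i$ on $\mathbb R^2$, with $A_i=\begin{pmatrix} b_i&0\\ d_i&a_i\end{pmatrix}$, $d_i\in\mathbb R$, $t_i=(t_{i,1},t_{i,2})^T$, $t_{i,1},t_{i,2}\ge0$, such that: (a) $0<a_i<b_i<1$ for all $i$; (b) $[N]$ is partitioned into $M>1$ nonempty consecutive blocks $\mathcal I_1,\dots,\mathcal I_M$ ("columns") with $|\mathcal I_m|=N_m$ ($\mathcal I_1=\{1,\dots,N_1\}$, $\mathcal I_m=\{N_1+\dots+N_{m-1}+1,\dots,N_1+\dots+N_m\}$), and for $k,\ell\in\mathcal I_m$ we have $b_k=b_\ell=:r_m$ and $t_{k,1}=t_{\ell,1}=:u_m$; put $\mathcal H=\{h_m(x)=r_mx+u_m\}_{m=1}^M$; (c) $\sum_{j\in\mathcal I_m}a_j\le1$ for every $m$, and $\sum_{m=1}^Mr_m\le1$; (d) $f_i([0,1]^2)\subset[0,1]^2$ for all $i$, and the smallest and largest fixed points of the maps of $\mathcal H$ are $0$ and $1$. The attractor $\Lambda$ of $\mathcal F=\{f_i\}_{i=1}^N$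 (the unique nonempty compact set with $\Lambda=\bigcup_if_i(\Lambda)$) is called a shifted TGL carpet. $\mathcal P$ is the set of probability vectors $\mathbf p=(p_1,\dots,p_N)$ and $\mathcal P_0\subset\mathcal P$ the subset with all $p_i>0$. For $\mathbf p\in\mathcal P$ let $\mathbf q=(q_1,\dots,q_M)$, $q_m=\sum_{j\in\mathcal I_m}p_j$. For positive vectors $\mathbf c$ write $\langle\mathbf c\rangle_{\mathbf p}=\prod_ic_i^{p_i}$ (so $\log\langle\mathbf p\rangle_{\mathbf p}=\sum_ip_i\log p_i$, $\log\langle\mathbf q\rangle_{\mathbf q}=\sum_mq_m\log q_m$, with $0\log0=0$), $\mathbf a=(a_i)$, $\mathbf b=(b_i)$. Define $$D(\mathbf p)=\frac{\log\langle\mathbf q\rangle_{\mathbf q}}{\log\langle\mathbf b\rangle_{\mathbf p}}+\frac{\log\langle\mathbf p\rangle_{\mathbf p}-\log\langle\mathbf q\rangle_{\mathbf q}}{\log\langle\mathbf a\rangle_{\mathbf p}} .$$ *)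

theory Defs
  imports "HOL-Analysis.Analysis"
begin

section \<open>Hausdorff dimension\<close>

(* diam(U)^s, where the empty set contributes 0 and 0^0 = 1 on nonempty sets, so that s = 0 gives
   the counting measure; powr alone has 0 powr 0 = 0. *)
definition diam_pow :: "real \<Rightarrow> 'a::metric_space set \<Rightarrow> real" where
  "diam_pow s U = (if U = {} then 0 else if s = 0 then 1 else diameter U powr s)"

(* Boundedness is required explicitly because diameter is unspecified on unbounded sets. *)
definition delta_covers :: "real \<Rightarrow> 'a::metric_space set \<Rightarrow> (nat \<Rightarrow> 'a set) set" where
  "delta_covers \<delta> A =
     {U. A \<subseteq> (\<Union>i. U i) \<and> (\<forall>i. bounded (U i) \<and> diameter (U i) \<le> \<delta>)}"

definition hausdorff_premeasure :: "real \<Rightarrow> real \<Rightarrow> 'a::metric_space set \<Rightarrow> ennreal" where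
  "hausdorff_premeasure s \<delta> A = (INF U\<in>delta_covers \<delta> A. \<Sum>i. ennreal (diam_pow s (U i)))"

definition hausdorff_measure :: "real \<Rightarrow> 'a::metric_space set \<Rightarrow> ennreal" where
  "hausdorff_measure s A = (SUP \<delta>\<in>{0<..}. hausdorff_premeasure s \<delta> A)"

definition hausdorff_dim :: "'a::metric_space set \<Rightarrow> ereal" where
  "hausdorff_dim A = (INF s\<in>{s. 0 \<le> s \<and> hausdorff_measure s A = 0}. ereal s)"

section \<open>Shifted triangular Gatzouras--Lalley carpets\<close>

definition is_attractor :: "'i set \<Rightarrow> ('i \<Rightarrow> 'a::topological_space \<Rightarrow> 'a) \<Rightarrow> 'a set \<Rightarrow> bool" where
  "is_attractor I f K \<longleftrightarrow> compact K \<and> K \<noteq> {} \<and> K = (\<Union>i\<in>I. f i ` K)"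

definition tgl_map ::
  "(nat \<Rightarrow> real) \<Rightarrow> (nat \<Rightarrow> real) \<Rightarrow> (nat \<Rightarrow> real) \<Rightarrow> (nat \<Rightarrow> real^2) \<Rightarrow> nat \<Rightarrow> real^2 \<Rightarrow> real^2" where
  "tgl_map a b d t i x = (vector [vector [b i, 0], vector [d i, a i]] :: real^2^2) *v x + t i"

(* The m-th block of consecutive indices, for block sizes Ns 1, Ns 2, ... *)
definition column :: "(nat \<Rightarrow> nat) \<Rightarrow> nat \<Rightarrow> nat set" where
  "column Ns m = {(\<Sum>k=1..<m. Ns k)<..(\<Sum>k=1..m. Ns k)}"

definition column_map :: "(nat \<Rightarrow> real) \<Rightarrow> (nat \<Rightarrow> real) \<Rightarrow> nat \<Rightarrow> real \<Rightarrow> real" where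
  "column_map r u m x = r m * x + u m"

definition column_fixpoints :: "nat \<Rightarrow> (nat \<Rightarrow> real) \<Rightarrow> (nat \<Rightarrow> real) \<Rightarrow> real set" where
  "column_fixpoints M r u = {x. \<exists>m\<in>{1..M}. column_map r u m x = x}"

(* In the last three assumptions: cbox 0 1 is the unit square (0 and 1 are the constant vectors), and
   column_fixpoints is finite and nonempty, each column_map being a contraction of the line. *)
locale shifted_TGL =
  fixes N M :: nat and Ns :: "nat \<Rightarrow> nat"
    and a b d :: "nat \<Rightarrow> real" and t :: "nat \<Rightarrow> real^2"
    and r u :: "nat \<Rightarrow> real"
  assumes translation_nonneg: "\<And>i. i \<in> {1..N} \<Longrightarrow> 0 \<le> t i $ 1 \<and> 0 \<le> t i $ 2"
    and contraction: "\<And>i. i \<in> {1..N} \<Longrightarrow> 0 < a i \<and> a i < b i \<and> b i < 1"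
    and M_gt_1: "1 < M"
    and column_nonempty: "\<And>m. m \<in> {1..M} \<Longrightarrow> 0 < Ns m"
    and N_eq: "N = (\<Sum>m=1..M. Ns m)"
    and column_width: "\<And>m k. m \<in> {1..M} \<Longrightarrow> k \<in> column Ns m \<Longrightarrow> b k = r m"
    and column_shift: "\<And>m k. m \<in> {1..M} \<Longrightarrow> k \<in> column Ns m \<Longrightarrow> t k $ 1 = u m"
    and column_height: "\<And>m. m \<in> {1..M} \<Longrightarrow> (\<Sum>j\<in>column Ns m. a j) \<le> 1"
    and total_width: "(\<Sum>m=1..M. r m) \<le> 1"
    and unit_square: "\<And>i. i \<in> {1..N} \<Longrightarrow> tgl_map a b d t i ` cbox 0 1 \<subseteq> cbox 0 1"
    and min_fixpoint: "Min (column_fixpoints M r u) = 0"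
    and max_fixpoint: "Max (column_fixpoints M r u) = 1"

section \<open>The dimension functional\<close>

(* A probability vector is a function of which only the values on {1..N} matter. *)
definition prob_vectors :: "nat \<Rightarrow> (nat \<Rightarrow> real) set" where
  "prob_vectors N = {p. (\<forall>i\<in>{1..N}. 0 \<le> p i) \<and> (\<Sum>i=1..N. p i) = 1}"

definition pos_prob_vectors :: "nat \<Rightarrow> (nat \<Rightarrow> real) set" where
  "pos_prob_vectors N = {p \<in> prob_vectors N. \<forall>i\<in>{1..N}. 0 < p i}"

definition column_probs :: "(nat \<Rightarrow> nat) \<Rightarrow> (nat \<Rightarrow> real) \<Rightarrow> nat \<Rightarrow> real" where
  "column_probs Ns p m = (\<Sum>j\<in>column Ns m. p j)"

(* Weighted geometric mean, the product of c_i^(p_i) over i in 1..n. Factors with exponent 0 are 1,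
   including 0^0, which is the convention 0 log 0 = 0 (0 powr 0 would be 0). *)
definition gmean :: "nat \<Rightarrow> (nat \<Rightarrow> real) \<Rightarrow> (nat \<Rightarrow> real) \<Rightarrow> real" where
  "gmean n c p = (\<Prod>i=1..n. if p i = 0 then 1 else c i powr p i)"

lemma ln_gmean:
  assumes "\<And>i. i \<in> {1..n} \<Longrightarrow> p i \<noteq> 0 \<Longrightarrow> 0 < c i"
  shows "ln (gmean n c p) = (\<Sum>i=1..n. p i * ln (c i))"
proof -
  have "(if p i = 0 then 1 else c i powr p i) \<noteq> 0" if "i \<in> {1..n}" for i
    using assms[OF that] by (cases "p i = 0") simp_all
  then have "ln (gmean n c p) = (\<Sum>i=1..n. ln (if p i = 0 then 1 else c i powr p i))"
    unfolding gmean_def by (intro ln_prod) blast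
  also have "\<dots> = (\<Sum>i=1..n. p i * ln (c i))"
    using assms by (intro sum.cong) (simp_all add: ln_powr)
  finally show ?thesis .
qed

definition dim_functional ::
  "nat \<Rightarrow> nat \<Rightarrow> (nat \<Rightarrow> nat) \<Rightarrow> (nat \<Rightarrow> real) \<Rightarrow> (nat \<Rightarrow> real) \<Rightarrow> (nat \<Rightarrow> real) \<Rightarrow> real" where
  "dim_functional N M Ns a b p =
     (let q = column_probs Ns p in
        ln (gmean M q q) / ln (gmean N b p)
        + (ln (gmean N p p) - ln (gmean M q q)) / ln (gmean N a p))"

(* The supremum is taken in the extended reals, so it is meaningful without a boundedness proof. *)
definition alpha_star ::
  "nat \<Rightarrow> nat \<Rightarrow> (nat \<Rightarrow> nat) \<Rightarrow> (nat \<Rightarrow> real) \<Rightarrow> (nat \<Rightarrow> real) \<Rightarrow> ereal" where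
  "alpha_star N M Ns a b = (SUP p\<in>prob_vectors N. ereal (dim_functional N M Ns a b p))"

end

theory Submission
  imports Defs
begin

text \<open>
  Write \<open>H\<close> for entropy, \<open>q\<close> for the column probabilities of \<open>p\<close>, and \<open>\<chi>\<^sub>a\<close>, \<open>\<chi>\<^sub>b\<close> for the averages of
  \<open>- ln a\<close>, \<open>- ln b\<close>, so that \<open>D(p) = H(q) / \<chi>\<^sub>b(p) + (H(p) - H(q)) / \<chi>\<^sub>a(p)\<close>.

  A point of the attractor is coded by a sequence of maps. Prescribing its first \<open>L\<close> maps \<open>v\<close> and only
  the columns \<open>w\<close> of the following \<open>n - L\<close> maps gives an approximate square when \<open>n\<close> is chosen so that
  the width \<open>r\<close> of the column cylinder of length \<open>n\<close> is comparable to the height \<open>a\<close> of the cylinder of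
  \<open>v\<close>: because \<open>a i < b i\<close>, the shear of the compositions stays bounded (\<open>word_map_2_dist\<close>), so the
  diameter is comparable to this height (\<open>approx_square_dist\<close>). If \<open>v\<close> has frequencies \<open>p\<close> and all \<open>n\<close>
  columns together have frequencies \<open>\<kappa>\<close>, there are, up to polynomial factors,
  \<open>exp (L (H(p) - H(q)) + n H(\<kappa>))\<close> such squares, of size \<open>exp (- L \<chi>\<^sub>a(p))\<close>, which is about
  \<open>exp (- n \<chi>\<^sub>b(\<kappa>))\<close>. They therefore have exponent
  \<open>H(\<kappa>) / \<chi>\<^sub>b(\<kappa>) + (H(p) - H(q)) / \<chi>\<^sub>a(p)\<close>. This is at most \<open>D(p) + \<epsilon>\<close>, provided that the
  column rate \<open>H / \<chi>\<^sub>b\<close> does not grow by more than \<open>\<epsilon>\<close> between the lengths \<open>L\<close> and \<open>n\<close>. A given coding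
  sequence has this property for arbitrarily large \<open>L\<close>, since otherwise the bounded rate would grow
  without limit along \<open>L\<close>, \<open>n(L)\<close>, \<open>n(n(L))\<close> and so on (\<open>good_scale\<close>). Hence these squares form
  efficient covers at all small scales.

  The count is organized by weights: each square gets the mass that its own empirical frequencies
  assign to it. There are polynomially many frequency vectors, and for each of them the masses of
  the squares with given lengths of \<open>v\<close> and \<open>w\<close> sum to at most \<open>1\<close> (\<open>sum_empirical_weight_le\<close>), while the mass of a square with
  controlled column rate is at least its height to the power \<open>sup D + \<epsilon>\<close> (\<open>empirical_weight_ge\<close>).

  The supremum of \<open>D\<close> is attained by compactness and continuity. At a vector with a zero weight,
  raising this weight to \<open>\<tau>\<close> gains entropy of order \<open>- \<tau> ln \<tau>\<close> at a cost of order \<open>\<tau>\<close>, so every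
  maximizer is positive (\<open>maximizer_pos\<close>).
\<close>

section \<open>A covering criterion for the vanishing of Hausdorff measure\<close>

text \<open>A cover indexed by a subset of a countable type is turned into a sequence of sets by placing
  the empty set, which contributes nothing, at all numbers that do not encode an index.\<close>

lemma hausdorff_premeasure_le_countable_cover:
  fixes A :: "'a::metric_space set" and C :: "'i::countable set"
  assumes cover: "A \<subseteq> (\<Union>c\<in>C. U c)" and "0 \<le> \<delta>"
    and small: "\<And>c. c \<in> C \<Longrightarrow> bounded (U c) \<and> diameter (U c) \<le> \<delta>"
    and sums: "\<And>F. finite F \<Longrightarrow> F \<subseteq> C \<Longrightarrow> (\<Sum>c\<in>F. diam_pow s (U c)) \<le> \<eta>"
  shows "hausdorff_premeasure s \<delta> A \<le> ennreal \<eta>"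
proof -
  define V where "V k = (if k \<in> to_nat ` C then U (from_nat k) else {})" for k
  have V_to_nat: "V (to_nat c) = U c" if "c \<in> C" for c
    using that by (simp add: V_def)
  have "V \<in> delta_covers \<delta> A"
    unfolding delta_covers_def
  proof (intro CollectI conjI allI)
    show "A \<subseteq> (\<Union>k. V k)"
      using cover V_to_nat by blast
    show "bounded (V k)" "diameter (V k) \<le> \<delta>" for k
      using small \<open>0 \<le> \<delta>\<close> by (auto simp: V_def)
  qed
  then have "hausdorff_premeasure s \<delta> A \<le> (\<Sum>k. ennreal (diam_pow s (V k)))"
    unfolding hausdorff_premeasure_def by (rule INF_lower)
  also have "\<dots> \<le> ennreal \<eta>"
  proof (rule suminf_le_const)
    fix n
    define F where "F = {c \<in> C. to_nat c < n}"
    have inj: "inj_on to_nat F" by (rule inj_on_subset[OF inj_to_nat]) simp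
    have "finite F"
      by (rule inj_on_finite[OF inj, of "{..<n}"]) (auto simp: F_def)
    have nonneg: "0 \<le> diam_pow s X" for X :: "'a set"
      by (simp add: diam_pow_def)
    have "(\<Sum>k<n. diam_pow s (V k)) = (\<Sum>k\<in>to_nat ` F. diam_pow s (V k))"
      by (rule sum.mono_neutral_right) (auto simp: F_def V_def diam_pow_def)
    also have "\<dots> = (\<Sum>c\<in>F. diam_pow s (U c))"
      unfolding sum.reindex[OF inj] o_def
      by (intro sum.cong refl arg_cong[where f = "diam_pow s"] V_to_nat) (simp add: F_def)
    also have "\<dots> \<le> \<eta>"
      using \<open>finite F\<close> by (intro sums) (auto simp: F_def)
    finally show "(\<Sum>k<n. ennreal (diam_pow s (V k))) \<le> ennreal \<eta>"
      by (simp add: sum_ennreal nonneg ennreal_leI)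
  qed simp
  finally show ?thesis .
qed

lemma hausdorff_measure_eq_0I:
  fixes A :: "'a::metric_space set" and U :: "'i::countable \<Rightarrow> 'a set"
  assumes "\<And>\<delta> \<eta>. 0 < \<delta> \<Longrightarrow> 0 < \<eta> \<Longrightarrow> \<exists>C. A \<subseteq> (\<Union>c\<in>C. U c) \<and>
      (\<forall>c\<in>C. bounded (U c) \<and> diameter (U c) \<le> \<delta>) \<and>
      (\<forall>F. finite F \<longrightarrow> F \<subseteq> C \<longrightarrow> (\<Sum>c\<in>F. diam_pow s (U c)) \<le> \<eta>)"
  shows "hausdorff_measure s A = 0"
proof -
  have "hausdorff_premeasure s \<delta> A \<le> 0" if "0 < \<delta>" for \<delta>
  proof (rule ennreal_le_epsilon)
    fix \<eta> :: real assume "0 < \<eta>"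
    from assms[OF that this] obtain C where "A \<subseteq> (\<Union>c\<in>C. U c)"
      "\<forall>c\<in>C. bounded (U c) \<and> diameter (U c) \<le> \<delta>"
      "\<forall>F. finite F \<longrightarrow> F \<subseteq> C \<longrightarrow> (\<Sum>c\<in>F. diam_pow s (U c)) \<le> \<eta>"
      by auto
    then show "hausdorff_premeasure s \<delta> A \<le> 0 + ennreal \<eta>"
      using hausdorff_premeasure_le_countable_cover[of A U C \<delta> s \<eta>] that by simp
  qed
  then show ?thesis
    unfolding hausdorff_measure_def by (simp add: SUP_eq_iff le_zero_eq)
qed

section \<open>Words and their empirical frequencies\<close>

definition words :: "'a set \<Rightarrow> nat \<Rightarrow> 'a list set" where
  "words A n = {v. set v \<subseteq> A \<and> length v = n}"

lemma finite_words: "finite A \<Longrightarrow> finite (words A n)"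
  unfolding words_def by (rule finite_lists_length_eq)

lemma words_Suc: "words A (Suc n) = (\<lambda>(x, v). x # v) ` (A \<times> words A n)"
  by (auto simp: words_def length_Suc_conv image_iff)

lemma sum_words_prod_list:
  fixes g :: "'a \<Rightarrow> real"
  assumes "finite A"
  shows "(\<Sum>v\<in>words A n. prod_list (map g v)) = (\<Sum>x\<in>A. g x) ^ n"
proof (induction n)
  case 0
  have "words A 0 = {[]}" by (auto simp: words_def)
  then show ?case by simp
next
  case (Suc n)
  have "inj_on (\<lambda>(x, v). x # v) (A \<times> words A n)"
    by (auto simp: inj_on_def)
  then have "(\<Sum>v\<in>words A (Suc n). prod_list (map g v)) =
      (\<Sum>(x, v)\<in>A \<times> words A n. g x * prod_list (map g v))"
    by (simp add: words_Suc sum.reindex case_prod_unfold)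
  also have "\<dots> = (\<Sum>x\<in>A. g x) * (\<Sum>v\<in>words A n. prod_list (map g v))"
    by (simp add: sum_product sum.cartesian_product)
  finally show ?case using Suc by simp
qed

lemma sum_list_eq_sum_count:
  fixes f :: "'a \<Rightarrow> real"
  assumes "set z \<subseteq> X" "finite X"
  shows "(\<Sum>x\<leftarrow>z. f x) = (\<Sum>x\<in>X. real (count_list z x) * f x)"
  using assms(1)
proof (induction z)
  case (Cons y z)
  have "(\<Sum>x\<in>X. real (count_list (y # z) x) * f x) =
      (\<Sum>x\<in>X. (if x = y then f x else 0) + real (count_list z x) * f x)"
    by (intro sum.cong) (auto simp: algebra_simps)
  then show ?case using Cons assms(2) by (simp add: sum.distrib sum.delta')
qed simp

lemma ln_prod_list:
  fixes f :: "'a \<Rightarrow> real"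
  assumes "\<And>x. x \<in> set z \<Longrightarrow> 0 < f x"
  shows "0 < prod_list (map f z) \<and> ln (prod_list (map f z)) = (\<Sum>x\<leftarrow>z. ln (f x))"
  using assms
proof (induction z)
  case (Cons y z)
  then have "0 < f y" "0 < prod_list (map f z)" by auto
  then show ?case using Cons by (auto simp: ln_mult_pos)
qed simp

lemma prod_list_powers_bounds:
  fixes f :: "'a \<Rightarrow> real"
  assumes "\<And>x. x \<in> set z \<Longrightarrow> 0 \<le> f x \<and> f x \<le> \<sigma>"
  shows "0 \<le> prod_list (map f z) \<and> prod_list (map f z) \<le> \<sigma> ^ length z"
  using assms
proof (induction z)
  case (Cons y z)
  then have "0 \<le> f y" "f y \<le> \<sigma>" by auto
  moreover from this have "0 \<le> \<sigma>" by linarith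
  ultimately show ?case using Cons by (auto intro!: mult_mono)
qed simp

definition empirical :: "'a list \<Rightarrow> 'a \<Rightarrow> real" where
  "empirical z x = real (count_list z x) / real (length z)"

lemma empirical_nonneg: "0 \<le> empirical z x"
  by (simp add: empirical_def)

lemma empirical_pos: "x \<in> set z \<Longrightarrow> 0 < empirical z x"
  using count_list_0_iff[of z x] by (cases z) (auto simp: empirical_def simp del: count_list.simps)

lemma sum_list_eq_sum_empirical:
  fixes f :: "'a \<Rightarrow> real"
  assumes "set z \<subseteq> X" "finite X"
  shows "(\<Sum>x\<leftarrow>z. f x) = length z * (\<Sum>x\<in>X. empirical z x * f x)"
  by (cases "z = []") (simp_all add: sum_list_eq_sum_count[OF assms] sum_distrib_left empirical_def)

lemma sum_empirical:
  assumes "set z \<subseteq> X" "finite X" "z \<noteq> []"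
  shows "(\<Sum>x\<in>X. empirical z x) = 1"
  using sum_list_eq_sum_empirical[OF assms(1,2), of "\<lambda>_. 1"] assms(3)
  by (simp add: sum_list_triv)

section \<open>Preliminaries for the maximization\<close>

lemma continuous_on_x_ln_x: "continuous_on {0..} (\<lambda>x::real. x * ln x)"
proof (rule continuous_on_eq_continuous_within[THEN iffD2], rule ballI)
  fix x :: real assume x: "x \<in> {0..}"
  show "continuous (at x within {0..}) (\<lambda>x. x * ln x)"
  proof (cases "x = 0")
    case True
    have "((\<lambda>x::real. - (ln x / x)) \<longlongrightarrow> - 0) at_top"
      by (intro tendsto_minus ln_x_over_x_tendsto_0)
    then have "((\<lambda>x::real. inverse x * ln (inverse x)) \<longlongrightarrow> 0) at_top"
      by (simp add: ln_inverse divide_inverse mult.commute)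
    then have "((\<lambda>x::real. x * ln x) \<longlongrightarrow> 0) (at_right 0)"
      by (simp add: filterlim_at_right_to_top)
    then show ?thesis
      using True by (simp add: continuous_within at_within_Ici_at_right)
  next
    case False
    then have "isCont (\<lambda>x. x * ln x) x" using x
      by (intro isCont_mult continuous_ident isCont_ln) auto
    then show ?thesis by (rule continuous_at_imp_continuous_at_within)
  qed
qed

lemma minus_x_ln_x_bounds:
  fixes x :: real
  assumes "0 \<le> x" "x \<le> 1"
  shows "0 \<le> - (x * ln x)" "- (x * ln x) \<le> 1"
proof -
  show "0 \<le> - (x * ln x)"
  proof (cases "x = 0")
    case False
    then have "ln x \<le> 0" using assms by simp
    then show ?thesis using mult_nonneg_nonpos[OF assms(1)] by simp
  qed simp
  show "- (x * ln x) \<le> 1"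
  proof (cases "x = 0")
    case False
    have "ln (1 / x) \<le> 1 / x - 1"
      using False assms by (intro ln_le_minus_one) auto
    then have "x * ln (1 / x) \<le> x * (1 / x - 1)"
      using assms by (intro mult_left_mono) auto
    then show ?thesis using False assms by (simp add: ln_div algebra_simps)
  qed simp
qed

lemma sum_fun_upd:
  fixes g :: "'a \<Rightarrow> 'b \<Rightarrow> real"
  assumes "finite A" "i \<in> A"
  shows "(\<Sum>j\<in>A. g j ((f(i := y)) j)) = (\<Sum>j\<in>A. g j (f j)) + (g i y - g i (f i))"
proof -
  have "(\<Sum>j\<in>A - {i}. g j ((f(i := y)) j)) = (\<Sum>j\<in>A - {i}. g j (f j))"
    by (intro sum.cong) auto
  then show ?thesis
    by (simp add: sum.remove[OF assms])
qed

lemma compact_coordinatewise: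
  fixes B :: "'i \<Rightarrow> 'a::topological_space set"
  assumes "\<And>i. compact (B i)"
  shows "compact {p. \<forall>i. p i \<in> B i}"
proof -
  have "compactin (product_topology (\<lambda>_. euclidean) UNIV) (PiE UNIV B)"
    using assms by (simp add: compactin_PiE)
  moreover have "PiE UNIV B = {p. \<forall>i. p i \<in> B i}"
    by (auto simp: PiE_iff)
  ultimately show ?thesis
    by (simp add: euclidean_product_topology)
qed

lemma gmean_cong:
  assumes "\<And>i. i \<in> {1..n} \<Longrightarrow> p i = p' i" "\<And>i. i \<in> {1..n} \<Longrightarrow> c i = c' i"
  shows "gmean n c p = gmean n c' p'"
  unfolding gmean_def using assms by (intro prod.cong) auto

context shifted_TGL
begin

section \<open>Columns\<close>

lemma columns_cover: "(\<Union>m\<in>{1..M}. column Ns m) = {1..N}"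
proof -
  have "(\<Union>m\<in>{1..n}. column Ns m) = {1..\<Sum>k=1..n. Ns k}" for n
  proof (induction n)
    case (Suc n)
    have "column Ns (Suc n) = {(\<Sum>k=1..n. Ns k)<..(\<Sum>k=1..n. Ns k) + Ns (Suc n)}"
      by (simp add: column_def atLeastLessThanSuc_atLeastAtMost)
    moreover have "{1..Suc n} = insert (Suc n) {1..n}" by auto
    ultimately show ?case using Suc by auto
  qed simp
  then show ?thesis using N_eq by simp
qed

lemma columns_disjoint:
  assumes "m \<noteq> m'"
  shows "column Ns m \<inter> column Ns m' = {}"
proof -
  have "column Ns m \<inter> column Ns m' = {}" if "m < m'" for m m'
  proof -
    have "(\<Sum>k=1..m. Ns k) \<le> (\<Sum>k=1..<m'. Ns k)"
      using that by (intro sum_mono2) auto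
    then show ?thesis by (auto simp: column_def)
  qed
  then show ?thesis using assms by (metis Int_commute nat_neq_iff)
qed

definition col :: "nat \<Rightarrow> nat" where
  "col i = (SOME m. m \<in> {1..M} \<and> i \<in> column Ns m)"

lemma col_in:
  assumes "i \<in> {1..N}"
  shows "col i \<in> {1..M}" "i \<in> column Ns (col i)"
proof -
  have "\<exists>m. m \<in> {1..M} \<and> i \<in> column Ns m"
    using assms columns_cover by blast
  from someI_ex[OF this] show "col i \<in> {1..M}" "i \<in> column Ns (col i)"
    by (auto simp: col_def)
qed

lemma in_column:
  assumes "m \<in> {1..M}" "i \<in> column Ns m"
  shows "i \<in> {1..N}" "col i = m"
proof -
  show i: "i \<in> {1..N}" using assms columns_cover by blast
  show "col i = m"
    using columns_disjoint[of "col i" m] col_in(2)[OF i] assms(2) by blast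
qed

lemma finite_column: "finite (column Ns m)"
  by (simp add: column_def)

lemma sum_columns:
  fixes g :: "nat \<Rightarrow> real"
  shows "(\<Sum>i=1..N. g i) = (\<Sum>m=1..M. \<Sum>j\<in>column Ns m. g j)"
  unfolding columns_cover[symmetric]
  using columns_disjoint by (intro sum.UNION_disjoint) (auto simp: finite_column)

lemma b_eq: "i \<in> {1..N} \<Longrightarrow> b i = r (col i)"
  using col_in column_width by blast

lemma shift_eq: "i \<in> {1..N} \<Longrightarrow> t i $ 1 = u (col i)"
  using col_in column_shift by blast

lemma column_has_element:
  assumes "m \<in> {1..M}"
  shows "\<exists>i. i \<in> column Ns m"
proof -
  have "{1..m} = insert m {1..<m}" using assms by auto
  then have "(\<Sum>k=1..<m. Ns k) < (\<Sum>k=1..m. Ns k)"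
    using column_nonempty[OF assms] by simp
  then show ?thesis by (auto simp: column_def intro: exI[of _ "\<Sum>k=1..m. Ns k"])
qed

lemma r_bounds: "m \<in> {1..M} \<Longrightarrow> 0 < r m \<and> r m < 1"
  using column_has_element[of m] in_column[of m] column_width[of m] contraction
  by (metis order_less_trans)

lemma N_pos: "0 < N"
proof -
  obtain i where "i \<in> column Ns 1" using column_has_element[of 1] M_gt_1 by auto
  then show ?thesis using in_column[of 1 i] M_gt_1 by simp
qed

section \<open>The dimension functional attains its maximum\<close>

lemma column_probs_nonneg:
  assumes "\<And>i. i \<in> {1..N} \<Longrightarrow> 0 \<le> p i" "m \<in> {1..M}"
  shows "0 \<le> column_probs Ns p m"
  unfolding column_probs_def using assms in_column by (intro sum_nonneg) blast

lemma sum_column_probs: "(\<Sum>m=1..M. column_probs Ns p m) = (\<Sum>i=1..N. p i)"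
  unfolding sum_columns column_probs_def ..

lemma prob_le_1: "p \<in> prob_vectors N \<Longrightarrow> i \<in> {1..N} \<Longrightarrow> p i \<le> 1"
  unfolding prob_vectors_def using member_le_sum[of i "{1..N}" p] by auto

lemma column_probs_le_1:
  assumes "p \<in> prob_vectors N" "m \<in> {1..M}"
  shows "column_probs Ns p m \<le> 1"
  using assms member_le_sum[of m "{1..M}" "column_probs Ns p"] column_probs_nonneg[of p]
  by (auto simp: sum_column_probs prob_vectors_def simp del: One_nat_def)

lemma dim_functional_eq:
  assumes "\<And>i. i \<in> {1..N} \<Longrightarrow> 0 \<le> p i"
  defines "q \<equiv> column_probs Ns p"
  shows "dim_functional N M Ns a b p =
    (\<Sum>m=1..M. q m * ln (q m)) / (\<Sum>i=1..N. p i * ln (b i)) +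
    ((\<Sum>i=1..N. p i * ln (p i)) - (\<Sum>m=1..M. q m * ln (q m))) / (\<Sum>i=1..N. p i * ln (a i))"
proof -
  have "0 \<le> q m" if "m \<in> {1..M}" for m
    using column_probs_nonneg assms that by blast
  then have "ln (gmean M q q) = (\<Sum>m=1..M. q m * ln (q m))"
    by (intro ln_gmean) (metis order_le_less)
  moreover have "ln (gmean N p p) = (\<Sum>i=1..N. p i * ln (p i))"
    using assms by (intro ln_gmean) (metis order_le_less)
  moreover have "ln (gmean N b p) = (\<Sum>i=1..N. p i * ln (b i))"
    "ln (gmean N a p) = (\<Sum>i=1..N. p i * ln (a i))"
    using contraction by (intro ln_gmean; force)+
  ultimately show ?thesis
    unfolding dim_functional_def q_def[symmetric] by (simp add: Let_def)
qed

lemma sum_ln_neg: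
  assumes "\<And>i. i \<in> {1..N} \<Longrightarrow> 0 \<le> p i" "0 < (\<Sum>i=1..N. p i)"
    and c: "\<And>i. i \<in> {1..N} \<Longrightarrow> 0 < c i \<and> c i < (1::real)"
  shows "(\<Sum>i=1..N. p i * ln (c i)) < 0"
proof -
  obtain i where i: "i \<in> {1..N}" "0 < p i"
    using assms(1,2) by (metis order_less_irrefl sum_nonpos not_le)
  have "0 < (\<Sum>i=1..N. p i * - ln (c i))"
  proof (rule sum_pos2[OF _ i(1)])
    show "0 < p i * - ln (c i)"
      using i c by (intro mult_pos_pos) auto
    show "0 \<le> p j * - ln (c j)" if "j \<in> {1..N}" for j
      using assms(1)[OF that] c[OF that] by (intro mult_nonneg_nonneg) auto
  qed simp
  then show ?thesis by (simp add: sum_negf)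
qed

lemma a_bounds: "i \<in> {1..N} \<Longrightarrow> 0 < a i \<and> a i < 1"
  and b_bounds: "i \<in> {1..N} \<Longrightarrow> 0 < b i \<and> b i < 1"
  using contraction by force+

text \<open>Only the coordinates in \<open>{1..N}\<close> matter, so the maximum may be sought among the probability
  vectors that vanish elsewhere; these form a compact set in the product topology, on which the
  functional is continuous because \<open>x ln x\<close> is continuous up to \<open>0\<close> and the denominators do not
  vanish.\<close>

lemma dim_functional_attains_max:
  "\<exists>p\<in>prob_vectors N. \<forall>p'\<in>prob_vectors N.
     dim_functional N M Ns a b p' \<le> dim_functional N M Ns a b p"
proof -
  define B where "B i = (if i \<in> {1..N} then {0..1::real} else {0})" for i
  define K where "K = {p. \<forall>i. p i \<in> B i} \<inter> {p. (\<Sum>i=1..N. p i) = 1}"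
  have coord: "continuous_on S (\<lambda>p::nat \<Rightarrow> real. p i)" for S i
    by (rule continuous_on_subset[OF continuous_on_product_coordinates]) simp
  have "compact K"
    unfolding K_def
  proof (rule compact_Int_closed)
    show "compact {p. \<forall>i. p i \<in> B i}"
      by (rule compact_coordinatewise) (simp add: B_def)
    show "closed {p::nat \<Rightarrow> real. (\<Sum>i=1..N. p i) = 1}"
      by (intro closed_Collect_eq continuous_on_sum coord continuous_on_const)
  qed
  moreover have "(\<lambda>i. if i = 1 then 1 else 0) \<in> K"
    using N_pos by (auto simp: K_def B_def)
  moreover have K: "K \<subseteq> prob_vectors N"
    by (force simp: K_def B_def prob_vectors_def split: if_splits)
  moreover have "continuous_on K (dim_functional N M Ns a b)"
  proof -
    have nonneg: "0 \<le> p i" if "p \<in> K" "i \<in> {1..N}" for p i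
      using K that by (auto simp: prob_vectors_def)
    have q: "continuous_on K (\<lambda>p. column_probs Ns p m)" for m
      unfolding column_probs_def by (intro continuous_on_sum coord)
    have xl: "continuous_on K (\<lambda>p. f p * ln (f p))"
      if "continuous_on K f" "\<And>p. p \<in> K \<Longrightarrow> 0 \<le> f p" for f :: "(nat \<Rightarrow> real) \<Rightarrow> real"
      using that by (intro continuous_on_compose2[OF continuous_on_x_ln_x]) auto
    have neg: "(\<Sum>i=1..N. p i * ln (c i)) < 0"
      if "p \<in> K" "\<And>i. i \<in> {1..N} \<Longrightarrow> 0 < c i \<and> c i < 1" for p and c :: "nat \<Rightarrow> real"
      using that nonneg by (intro sum_ln_neg) (auto simp: K_def)
    have "continuous_on K (\<lambda>p.
      (\<Sum>m=1..M. column_probs Ns p m * ln (column_probs Ns p m)) / (\<Sum>i=1..N. p i * ln (b i)) +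
      ((\<Sum>i=1..N. p i * ln (p i)) - (\<Sum>m=1..M. column_probs Ns p m * ln (column_probs Ns p m)))
        / (\<Sum>i=1..N. p i * ln (a i)))"
      using neg[OF _ a_bounds] neg[OF _ b_bounds] nonneg
      by (intro continuous_on_add continuous_on_divide continuous_on_diff continuous_on_sum xl q
          coord continuous_on_mult continuous_on_const column_probs_nonneg) force+
    then show ?thesis
      by (rule continuous_on_eq, intro dim_functional_eq[symmetric] nonneg)
  qed
  ultimately obtain p where p: "p \<in> K"
    "\<And>p'. p' \<in> K \<Longrightarrow> dim_functional N M Ns a b p' \<le> dim_functional N M Ns a b p"
    using continuous_attains_sup[of K "dim_functional N M Ns a b"] by blast
  have "dim_functional N M Ns a b p' \<le> dim_functional N M Ns a b p"
    if p': "p' \<in> prob_vectors N" for p'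
  proof -
    define p'' where "p'' i = (if i \<in> {1..N} then p' i else 0)" for i
    have eq: "p'' i = p' i" if "i \<in> {1..N}" for i
      using that by (simp add: p''_def)
    have "p'' \<in> K"
      using p' prob_le_1[OF p'] by (auto simp: K_def B_def p''_def prob_vectors_def)
    moreover have "dim_functional N M Ns a b p'' = dim_functional N M Ns a b p'"
    proof -
      have "column_probs Ns p'' m = column_probs Ns p' m" if "m \<in> {1..M}" for m
        unfolding column_probs_def using in_column[OF that] eq by (intro sum.cong) auto
      then have "gmean M (column_probs Ns p'') (column_probs Ns p'') =
          gmean M (column_probs Ns p') (column_probs Ns p')"
        by (intro gmean_cong)
      moreover have "gmean N c p'' = gmean N c' p'" if "\<And>i. i \<in> {1..N} \<Longrightarrow> c i = c' i" for c c'
        by (rule gmean_cong[OF eq that])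
      ultimately show ?thesis
        unfolding dim_functional_def Let_def using eq by metis
    qed
    ultimately show ?thesis using p(2) by metis
  qed
  then show ?thesis using p(1) K by blast
qed

end

section \<open>Every maximizer is positive\<close>

text \<open>The effect of a small increase \<open>\<tau>\<close> of one weight on one of the two summands of the functional:
  the denominator grows by \<open>\<tau> * \<beta>\<close>, and apart from an entropy gain \<open>g\<close> the numerator loses at most
  \<open>c * \<tau>\<close>.\<close>

lemma perturbed_quotient_lower_bound:
  fixes X E Z c g \<beta> \<tau> :: real
  assumes "0 < X" "0 < \<beta>" "0 < \<tau>" "\<tau> \<le> 1" "0 \<le> c" "0 \<le> g" "E - c * \<tau> + g \<le> Z"
  shows "E / X - \<tau> * (c / X + \<bar>E\<bar> * \<beta> / X\<^sup>2) + g / (X + \<beta>) \<le> Z / (X + \<tau> * \<beta>)"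
proof -
  define X' where "X' = X + \<tau> * \<beta>"
  have X': "X \<le> X'" "X' \<le> X + \<beta>" "0 < X'"
    using assms by (auto simp: X'_def add_pos_pos mult_left_le_one_le)
  have "g / (X + \<beta>) \<le> g / X'"
    using assms X' by (intro divide_left_mono) auto
  moreover have "\<tau> * (c / X) \<ge> c * \<tau> / X'"
    using divide_left_mono[OF X'(1), of "c * \<tau>"] assms X' by (simp add: mult.commute)
  moreover have "E / X - E / X' \<le> \<tau> * (\<bar>E\<bar> * \<beta> / X\<^sup>2)"
  proof -
    have "E / X - E / X' = E * (\<tau> * \<beta>) / (X * X')"
      using assms X' by (simp add: X'_def field_simps)
    also have "\<dots> \<le> \<bar>E\<bar> * (\<tau> * \<beta>) / (X * X')"
      using assms X' by (intro divide_right_mono mult_right_mono) auto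
    also have "\<dots> \<le> \<bar>E\<bar> * (\<tau> * \<beta>) / (X * X)"
      using assms X' by (intro divide_left_mono mult_left_mono) auto
    finally show ?thesis by (simp add: power2_eq_square algebra_simps)
  qed
  moreover have "(E - c * \<tau> + g) / X' \<le> Z / X'"
    using assms X' by (intro divide_right_mono) auto
  ultimately have "E / X - \<tau> * (c / X) - \<tau> * (\<bar>E\<bar> * \<beta> / X\<^sup>2) + g / (X + \<beta>) \<le> Z / X'"
    by (simp add: diff_divide_distrib add_divide_distrib)
  then show ?thesis by (simp add: X'_def algebra_simps)
qed

lemma x_ln_x_div:
  fixes x s :: real
  assumes "0 \<le> x" "0 < s"
  shows "x / s * ln (x / s) = (x * ln x - x * ln s) / s"
  using assms by (cases "x = 0") (simp_all add: ln_div algebra_simps diff_divide_distrib)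

context shifted_TGL
begin

text \<open>The functional extended to unnormalized weights as a function homogeneous of degree \<open>0\<close>. It
  allows a single weight to be varied while the others stay fixed.\<close>

lemma dim_functional_normalized:
  assumes nonneg: "\<And>i. i \<in> {1..N} \<Longrightarrow> 0 \<le> p i" and pos: "0 < s"
    and s: "s = (\<Sum>i=1..N. p i)"
  defines "q \<equiv> column_probs Ns p"
  shows "dim_functional N M Ns a b (\<lambda>i. p i / s) =
    (s * ln s - (\<Sum>m=1..M. q m * ln (q m))) / (\<Sum>i=1..N. p i * - ln (b i)) +
    ((\<Sum>m=1..M. q m * ln (q m)) - (\<Sum>i=1..N. p i * ln (p i))) / (\<Sum>i=1..N. p i * - ln (a i))"
proof -
  have q: "column_probs Ns (\<lambda>i. p i / s) m = q m / s" for m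
    by (simp add: q_def column_probs_def sum_divide_distrib)
  have normalize: "(\<Sum>k\<in>A. f k / s * ln (f k / s)) = ((\<Sum>k\<in>A. f k * ln (f k)) - s * ln s) / s"
    if "\<And>k. k \<in> A \<Longrightarrow> 0 \<le> f k" "(\<Sum>k\<in>A. f k) = s" for A and f :: "nat \<Rightarrow> real"
  proof -
    have "(\<Sum>k\<in>A. f k / s * ln (f k / s)) = (\<Sum>k\<in>A. (f k * ln (f k) - f k * ln s) / s)"
      using that pos by (intro sum.cong x_ln_x_div) auto
    also have "\<dots> = ((\<Sum>k\<in>A. f k * ln (f k)) - (\<Sum>k\<in>A. f k) * ln s) / s"
      by (simp add: sum_divide_distrib[symmetric] sum_subtractf sum_distrib_right)
    finally show ?thesis using that by simp
  qed
  have Q: "(\<Sum>m=1..M. q m / s * ln (q m / s)) = ((\<Sum>m=1..M. q m * ln (q m)) - s * ln s) / s"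
    by (rule normalize) (use nonneg s in \<open>auto simp: q_def sum_column_probs
      intro!: column_probs_nonneg simp del: One_nat_def\<close>)
  have P: "(\<Sum>i=1..N. p i / s * ln (p i / s)) = ((\<Sum>i=1..N. p i * ln (p i)) - s * ln s) / s"
    by (rule normalize) (use nonneg s in auto)
  have C: "(\<Sum>i=1..N. p i / s * ln (c i)) = - (\<Sum>i=1..N. p i * - ln (c i)) / s" for c
    by (simp add: sum_divide_distrib sum_negf)
  have cancel: "x / s / (- y / s) = - x / y" for x y
    using pos by simp
  have "dim_functional N M Ns a b (\<lambda>i. p i / s) =
    (\<Sum>m=1..M. q m / s * ln (q m / s)) / (\<Sum>i=1..N. p i / s * ln (b i)) +
    ((\<Sum>i=1..N. p i / s * ln (p i / s)) - (\<Sum>m=1..M. q m / s * ln (q m / s)))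
      / (\<Sum>i=1..N. p i / s * ln (a i))"
    using nonneg pos by (subst dim_functional_eq) (auto simp: q)
  also have "\<dots> = - ((\<Sum>m=1..M. q m * ln (q m)) - s * ln s) / (\<Sum>i=1..N. p i * - ln (b i)) +
    - ((\<Sum>i=1..N. p i * ln (p i)) - (\<Sum>m=1..M. q m * ln (q m)))
      / (\<Sum>i=1..N. p i * - ln (a i))"
    unfolding P Q C diff_divide_distrib[symmetric] cancel by simp
  finally show ?thesis by simp
qed

text \<open>If a maximizer \<open>p\<close> had \<open>p i = 0\<close>, raising this weight to \<open>\<tau>\<close> would cost \<open>O(\<tau>)\<close> and gain entropy
  of order \<open>- \<tau> ln \<tau>\<close>, which is larger for small \<open>\<tau>\<close>. The gain is in the column entropy if the whole
  column of \<open>i\<close> had mass \<open>0\<close>, and in the entropy within the column otherwise.\<close>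

lemma maximizer_pos:
  assumes p: "p \<in> prob_vectors N" and i: "i \<in> {1..N}"
    and max: "\<And>p'. p' \<in> prob_vectors N \<Longrightarrow> dim_functional N M Ns a b p' \<le> dim_functional N M Ns a b p"
  shows "0 < p i"
proof (rule ccontr)
  assume "\<not> 0 < p i"
  with p i have pi: "p i = 0" by (auto simp: prob_vectors_def order_less_le)
  have nonneg: "\<And>j. j \<in> {1..N} \<Longrightarrow> 0 \<le> p j" and sum1: "(\<Sum>j=1..N. p j) = 1"
    using p by (auto simp: prob_vectors_def)
  define q where "q = column_probs Ns p"
  define m where "m = col i"
  have m: "m \<in> {1..M}" "i \<in> column Ns m" using col_in[OF i] by (auto simp: m_def)
  have Q: "0 \<le> q m" "q m \<le> 1"
    using column_probs_nonneg[OF nonneg m(1)] column_probs_le_1[OF p m(1)] by (auto simp: q_def)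
  define X where "X = (\<Sum>j=1..N. p j * - ln (b j))"
  define Y where "Y = (\<Sum>j=1..N. p j * - ln (a j))"
  define E where "E = - (\<Sum>k=1..M. q k * ln (q k))"
  define G where "G = (\<Sum>k=1..M. q k * ln (q k)) - (\<Sum>j=1..N. p j * ln (p j))"
  define \<beta> where "\<beta> = - ln (b i)"
  define \<gamma> where "\<gamma> = - ln (a i)"
  have pos: "0 < X" "0 < Y" "0 < \<beta>" "0 < \<gamma>"
    using sum_ln_neg[OF nonneg _ b_bounds] sum_ln_neg[OF nonneg _ a_bounds] sum1
      a_bounds[OF i] b_bounds[OF i]
    by (auto simp: X_def Y_def \<beta>_def \<gamma>_def sum_negf)
  have D: "dim_functional N M Ns a b p = E / X + G / Y"
    using dim_functional_normalized[OF nonneg zero_less_one sum1[symmetric]]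
    by (simp add: E_def G_def X_def Y_def q_def)
  \<comment> \<open>The two numerators after the weight of \<open>i\<close> has been raised from \<open>0\<close> to \<open>\<tau>\<close>.\<close>
  define Z\<^sub>1 where "Z\<^sub>1 \<tau> = (1 + \<tau>) * ln (1 + \<tau>) + E - ((q m + \<tau>) * ln (q m + \<tau>) - q m * ln (q m))" for \<tau>
  define Z\<^sub>2 where "Z\<^sub>2 \<tau> = G + ((q m + \<tau>) * ln (q m + \<tau>) - q m * ln (q m)) - \<tau> * ln \<tau>" for \<tau>
  have perturbed: "Z\<^sub>1 \<tau> / (X + \<tau> * \<beta>) + Z\<^sub>2 \<tau> / (Y + \<tau> * \<gamma>) \<le> E / X + G / Y"
    if \<tau>: "0 < \<tau>" for \<tau>
  proof -
    define p' where "p' = p(i := \<tau>)"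
    define q' where "q' = q(m := q m + \<tau>)"
    have s: "(\<Sum>j=1..N. p' j) = 1 + \<tau>"
      using sum_fun_upd[of "{1..N}" i "\<lambda>_ y. y" p \<tau>] i sum1 pi by (simp add: p'_def)
    have nonneg': "0 \<le> p' j" if "j \<in> {1..N}" for j
      using that nonneg \<tau> by (simp add: p'_def)
    have cp: "column_probs Ns p' k = q' k" if "k \<in> {1..M}" for k
    proof (cases "k = m")
      case True
      then show ?thesis
        using sum_fun_upd[OF finite_column m(2), of "\<lambda>_ y. y" p \<tau>] pi
        by (simp add: p'_def q'_def q_def column_probs_def)
    next
      case False
      then have "i \<notin> column Ns k" using in_column[OF that] m_def by blast
      then show ?thesis using False
        by (auto simp: p'_def q'_def q_def column_probs_def intro!: sum.cong)
    qed
    have "(\<lambda>j. p' j / (1 + \<tau>)) \<in> prob_vectors N"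
      using nonneg' s \<tau> by (simp add: prob_vectors_def sum_divide_distrib[symmetric])
    from max[OF this] have le: "dim_functional N M Ns a b (\<lambda>j. p' j / (1 + \<tau>)) \<le> E / X + G / Y"
      by (simp add: D)
    have e1: "(\<Sum>k=1..M. column_probs Ns p' k * ln (column_probs Ns p' k)) =
      - E + ((q m + \<tau>) * ln (q m + \<tau>) - q m * ln (q m))"
      using sum_fun_upd[of "{1..M}" m "\<lambda>_ y. y * ln y" q "q m + \<tau>"] m
      by (simp add: cp E_def q'_def del: One_nat_def)
    have e2: "(\<Sum>j=1..N. p' j * ln (p' j)) = (\<Sum>j=1..N. p j * ln (p j)) + \<tau> * ln \<tau>"
      using sum_fun_upd[of "{1..N}" i "\<lambda>_ y. y * ln y" p \<tau>] i pi by (simp add: p'_def)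
    have e3: "(\<Sum>j=1..N. p' j * - ln (b j)) = X + \<tau> * \<beta>"
      using sum_fun_upd[of "{1..N}" i "\<lambda>j y. y * - ln (b j)" p \<tau>] i pi
      by (simp add: p'_def X_def \<beta>_def)
    have e4: "(\<Sum>j=1..N. p' j * - ln (a j)) = Y + \<tau> * \<gamma>"
      using sum_fun_upd[of "{1..N}" i "\<lambda>j y. y * - ln (a j)" p \<tau>] i pi
      by (simp add: p'_def Y_def \<gamma>_def)
    have e5: "dim_functional N M Ns a b (\<lambda>j. p' j / (1 + \<tau>)) =
      ((1 + \<tau>) * ln (1 + \<tau>) - (\<Sum>k=1..M. column_probs Ns p' k * ln (column_probs Ns p' k)))
        / (\<Sum>j=1..N. p' j * - ln (b j)) +
      ((\<Sum>k=1..M. column_probs Ns p' k * ln (column_probs Ns p' k)) - (\<Sum>j=1..N. p' j * ln (p' j)))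
        / (\<Sum>j=1..N. p' j * - ln (a j))"
      using nonneg' \<tau> s by (intro dim_functional_normalized) auto
    have Z: "Z\<^sub>1 \<tau> = (1 + \<tau>) * ln (1 + \<tau>) - (- E + ((q m + \<tau>) * ln (q m + \<tau>) - q m * ln (q m)))"
      "Z\<^sub>2 \<tau> = - E + ((q m + \<tau>) * ln (q m + \<tau>) - q m * ln (q m)) -
        ((\<Sum>j=1..N. p j * ln (p j)) + \<tau> * ln \<tau>)"
      by (simp_all add: Z\<^sub>1_def Z\<^sub>2_def E_def G_def)
    show ?thesis
      using le unfolding e5 e1 e2 e3 e4 Z .
  qed
  define bound where "bound K W \<longleftrightarrow> 0 < W \<and> (\<forall>\<tau>. 0 < \<tau> \<and> \<tau> \<le> 1 \<longrightarrow> - (\<tau> * ln \<tau>) / W \<le> \<tau> * K)"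
    for K W :: real
  have "\<exists>K W. bound K W"
  proof (cases "q m = 0")
    case True
    have "- (\<tau> * ln \<tau>) / (X + \<beta>) \<le> \<tau> * (\<bar>E\<bar> * \<beta> / X\<^sup>2 + \<bar>G\<bar> * \<gamma> / Y\<^sup>2)" if "0 < \<tau>" "\<tau> \<le> 1" for \<tau>
    proof -
      have "0 \<le> (1 + \<tau>) * ln (1 + \<tau>)" using that by simp
      then have "E - 0 * \<tau> + - (\<tau> * ln \<tau>) \<le> Z\<^sub>1 \<tau>"
        unfolding Z\<^sub>1_def True by simp
      from perturbed_quotient_lower_bound[OF pos(1) pos(3) that _ _ this]
      have "E / X - \<tau> * (0 / X + \<bar>E\<bar> * \<beta> / X\<^sup>2) + - (\<tau> * ln \<tau>) / (X + \<beta>) \<le> Z\<^sub>1 \<tau> / (X + \<tau> * \<beta>)"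
        using minus_x_ln_x_bounds[of \<tau>] that by simp
      moreover have "G - 0 * \<tau> + 0 \<le> Z\<^sub>2 \<tau>"
        unfolding Z\<^sub>2_def True by simp
      from perturbed_quotient_lower_bound[OF pos(2) pos(4) that _ _ this]
      have "G / Y - \<tau> * (0 / Y + \<bar>G\<bar> * \<gamma> / Y\<^sup>2) + 0 / (Y + \<gamma>) \<le> Z\<^sub>2 \<tau> / (Y + \<tau> * \<gamma>)" by simp
      ultimately show ?thesis
        using perturbed[OF that(1)] by (simp add: algebra_simps)
    qed
    moreover have "0 < X + \<beta>" using pos by simp
    ultimately have "bound (\<bar>E\<bar> * \<beta> / X\<^sup>2 + \<bar>G\<bar> * \<gamma> / Y\<^sup>2) (X + \<beta>)"
      unfolding bound_def by blast
    then show ?thesis by blast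

  next
    case False
    define c where "c = - ln (q m)"
    have "0 \<le> c" using Q False by (simp add: c_def)
    have "- (\<tau> * ln \<tau>) / (Y + \<gamma>) \<le>
        \<tau> * ((2 / X + \<bar>E\<bar> * \<beta> / X\<^sup>2) + (c / Y + \<bar>G\<bar> * \<gamma> / Y\<^sup>2))" if "0 < \<tau>" "\<tau> \<le> 1" for \<tau>
    proof -
      have pos': "0 < q m" using Q False by simp
      have upper: "(q m + \<tau>) * ln (q m + \<tau>) - q m * ln (q m) \<le> 2 * \<tau>"
      proof -
        have "ln (q m + \<tau>) - ln (q m) = ln ((q m + \<tau>) / q m)"
          using pos' that by (simp add: ln_div)
        also have "\<dots> \<le> (q m + \<tau>) / q m - 1"
          using pos' that by (intro ln_le_minus_one) simp
        also have "\<dots> = \<tau> / q m" using pos' by (simp add: field_simps)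
        finally have "q m * (ln (q m + \<tau>) - ln (q m)) \<le> q m * (\<tau> / q m)"
          using pos' by (intro mult_left_mono) auto
        moreover have "ln (q m + \<tau>) \<le> 1"
          using ln_le_minus_one[of "q m + \<tau>"] pos' that Q by simp
        then have "\<tau> * ln (q m + \<tau>) \<le> \<tau> * 1"
          using that by (intro mult_left_mono) auto
        ultimately show ?thesis using pos' by (simp add: algebra_simps)
      qed
      have lower: "(q m + \<tau>) * ln (q m + \<tau>) - q m * ln (q m) \<ge> - (c * \<tau>)"
      proof -
        have "(q m + \<tau>) * ln (q m) \<le> (q m + \<tau>) * ln (q m + \<tau>)"
          using pos' that by (intro mult_left_mono) auto
        then show ?thesis by (simp add: c_def algebra_simps)
      qed
      have "0 \<le> (1 + \<tau>) * ln (1 + \<tau>)" using that by simp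
      then have "E - 2 * \<tau> + 0 \<le> Z\<^sub>1 \<tau>"
        unfolding Z\<^sub>1_def using upper by linarith
      from perturbed_quotient_lower_bound[OF pos(1) pos(3) that _ _ this]
      have "E / X - \<tau> * (2 / X + \<bar>E\<bar> * \<beta> / X\<^sup>2) + 0 / (X + \<beta>) \<le> Z\<^sub>1 \<tau> / (X + \<tau> * \<beta>)" by simp
      moreover have "G - c * \<tau> + - (\<tau> * ln \<tau>) \<le> Z\<^sub>2 \<tau>"
        unfolding Z\<^sub>2_def using lower by linarith
      from perturbed_quotient_lower_bound[OF pos(2) pos(4) that _ _ this]
      have "G / Y - \<tau> * (c / Y + \<bar>G\<bar> * \<gamma> / Y\<^sup>2) + - (\<tau> * ln \<tau>) / (Y + \<gamma>) \<le> Z\<^sub>2 \<tau> / (Y + \<tau> * \<gamma>)"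
        using minus_x_ln_x_bounds[of \<tau>] that \<open>0 \<le> c\<close> by simp
      ultimately show ?thesis
        using perturbed[OF that(1)] by (simp add: distrib_left)
    qed
    moreover have "0 < Y + \<gamma>" using pos by simp
    ultimately have "bound ((2 / X + \<bar>E\<bar> * \<beta> / X\<^sup>2) + (c / Y + \<bar>G\<bar> * \<gamma> / Y\<^sup>2)) (Y + \<gamma>)"
      unfolding bound_def by blast
    then show ?thesis by blast

  qed
  then obtain K W where "bound K W" by blast
  then have W: "0 < W" by (simp add: bound_def)
  have KW: "- (\<tau> * ln \<tau>) / W \<le> \<tau> * K" if "0 < \<tau>" "\<tau> \<le> 1" for \<tau>
    using \<open>bound K W\<close> that by (simp add: bound_def)
  \<comment> \<open>Any \<open>\<tau>\<close> with \<open>- ln \<tau> > K * W\<close> contradicts the bound.\<close>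
  define \<tau> where "\<tau> = exp (- (\<bar>K\<bar> * W + 1))"
  have "0 \<le> \<bar>K\<bar> * W" using W by simp
  then have "0 < \<tau>" "\<tau> \<le> 1" by (simp_all add: \<tau>_def)
  from KW[OF this] have "\<tau> * (\<bar>K\<bar> * W + 1) \<le> \<tau> * (K * W)"
    using W by (simp add: \<tau>_def divide_le_eq algebra_simps)
  then have "\<bar>K\<bar> * W + 1 \<le> K * W" using \<open>0 < \<tau>\<close> by simp
  moreover have "K * W \<le> \<bar>K\<bar> * W" using W by (intro mult_right_mono) auto
  ultimately show False by simp
qed

end

section \<open>Approximate squares\<close>

context shifted_TGL
begin

lemma tgl_map_1: "tgl_map a b d t i x $ 1 = b i * x $ 1 + t i $ 1"
  and tgl_map_2: "tgl_map a b d t i x $ 2 = d i * x $ 1 + a i * x $ 2 + t i $ 2"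
  by (simp_all add: tgl_map_def matrix_vector_mult_def sum_2)

lemma word_map_1:
  assumes "set v \<subseteq> {1..N}"
  shows "foldr (tgl_map a b d t) v x $ 1 = foldr (column_map r u) (map col v) (x $ 1)"
  using assms by (induction v) (simp_all add: tgl_map_1 column_map_def b_eq shift_eq)

lemma column_word_map_dist:
  assumes "set w \<subseteq> {1..M}"
  shows "\<bar>foldr (column_map r u) w x - foldr (column_map r u) w y\<bar> = prod_list (map r w) * \<bar>x - y\<bar>"
  using assms
proof (induction w)
  case (Cons m w)
  have "foldr (column_map r u) (m # w) x - foldr (column_map r u) (m # w) y =
      r m * (foldr (column_map r u) w x - foldr (column_map r u) w y)"
    by (simp add: column_map_def algebra_simps)
  then show ?case using Cons r_bounds[of m] by (simp add: abs_mult)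
qed simp

text \<open>A bound on the slope of the images of horizontal segments under all compositions of the maps.
  It solves \<open>\<bar>d i\<bar> + a i * c \<le> b i * c\<close> for all \<open>i\<close>, and is finite because \<open>a i < b i\<close>.\<close>

definition max_slope :: real where
  "max_slope = (\<Sum>i=1..N. \<bar>d i\<bar> / (b i - a i))"

lemma max_slope_nonneg: "0 \<le> max_slope"
  unfolding max_slope_def using contraction by (intro sum_nonneg) force

lemma max_slope_step:
  assumes i: "i \<in> {1..N}"
  shows "\<bar>d i\<bar> + a i * max_slope \<le> b i * max_slope"
proof -
  have "\<bar>d i\<bar> / (b i - a i) \<le> max_slope"
    unfolding max_slope_def
    using contraction by (intro member_le_sum[OF i]) force+
  then show ?thesis
    using contraction[OF i] by (simp add: divide_le_eq algebra_simps)
qed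

lemma word_map_2_dist:
  assumes "set v \<subseteq> {1..N}"
  shows "\<bar>foldr (tgl_map a b d t) v x $ 2 - foldr (tgl_map a b d t) v y $ 2\<bar> \<le>
    prod_list (map a v) * \<bar>x $ 2 - y $ 2\<bar>
    + max_slope * (prod_list (map r (map col v)) * \<bar>x $ 1 - y $ 1\<bar>)"
  using assms
proof (induction v)
  case Nil
  then show ?case using max_slope_nonneg by simp
next
  case (Cons i v)
  let ?F = "foldr (tgl_map a b d t) v"
  define \<Delta>\<^sub>1 where "\<Delta>\<^sub>1 = prod_list (map r (map col v)) * \<bar>x $ 1 - y $ 1\<bar>"
  define \<Delta>\<^sub>2 where "\<Delta>\<^sub>2 = prod_list (map a v) * \<bar>x $ 2 - y $ 2\<bar>"
  have i: "i \<in> {1..N}" and v: "set v \<subseteq> {1..N}" using Cons by auto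
  have "set (map col v) \<subseteq> {1..M}" using v col_in by auto
  then have d1: "\<bar>?F x $ 1 - ?F y $ 1\<bar> = \<Delta>\<^sub>1"
    unfolding word_map_1[OF v] \<Delta>\<^sub>1_def by (rule column_word_map_dist)
  have d2: "\<bar>?F x $ 2 - ?F y $ 2\<bar> \<le> \<Delta>\<^sub>2 + max_slope * \<Delta>\<^sub>1"
    using Cons.IH[OF v] by (simp add: \<Delta>\<^sub>1_def \<Delta>\<^sub>2_def)
  have "0 \<le> \<Delta>\<^sub>1" using d1 by linarith
  have "foldr (tgl_map a b d t) (i # v) x $ 2 - foldr (tgl_map a b d t) (i # v) y $ 2 =
      d i * (?F x $ 1 - ?F y $ 1) + a i * (?F x $ 2 - ?F y $ 2)"
    by (simp add: tgl_map_2 algebra_simps)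
  then have "\<bar>foldr (tgl_map a b d t) (i # v) x $ 2 - foldr (tgl_map a b d t) (i # v) y $ 2\<bar> \<le>
      \<bar>d i\<bar> * \<Delta>\<^sub>1 + a i * \<bar>?F x $ 2 - ?F y $ 2\<bar>"
    using abs_triangle_ineq[of "d i * (?F x $ 1 - ?F y $ 1)" "a i * (?F x $ 2 - ?F y $ 2)"]
      a_bounds[OF i] d1 by (simp add: abs_mult)
  also have "\<dots> \<le> \<bar>d i\<bar> * \<Delta>\<^sub>1 + a i * (\<Delta>\<^sub>2 + max_slope * \<Delta>\<^sub>1)"
    using d2 a_bounds[OF i] by (intro add_left_mono mult_left_mono) auto
  also have "\<dots> = a i * \<Delta>\<^sub>2 + (\<bar>d i\<bar> + a i * max_slope) * \<Delta>\<^sub>1"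
    by (simp add: algebra_simps)
  also have "\<dots> \<le> a i * \<Delta>\<^sub>2 + (b i * max_slope) * \<Delta>\<^sub>1"
    using max_slope_step[OF i] \<open>0 \<le> \<Delta>\<^sub>1\<close> by (intro add_left_mono mult_right_mono) auto
  finally show ?case
    by (simp add: \<Delta>\<^sub>1_def \<Delta>\<^sub>2_def b_eq[OF i] algebra_simps)
qed

text \<open>The points coded by sequences that start with the word \<open>v\<close> of maps and continue through the
  columns of \<open>w\<close>. If the height of the cylinder of \<open>v\<close> is comparable to the width of the column
  cylinder of \<open>map col v @ w\<close>, this is a set of roughly equal width and height.\<close>

definition approx_square :: "(real^2) set \<Rightarrow> nat list \<Rightarrow> nat list \<Rightarrow> (real^2) set" where
  "approx_square \<Lambda> v w = foldr (tgl_map a b d t) v `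
     {y \<in> \<Lambda>. \<exists>z\<in>\<Lambda>. y $ 1 = foldr (column_map r u) w (z $ 1)}"

lemma approx_square_dist:
  assumes v: "set v \<subseteq> {1..N}" and w: "set w \<subseteq> {1..M}"
    and R: "\<And>x y. x \<in> \<Lambda> \<Longrightarrow> y \<in> \<Lambda> \<Longrightarrow> dist x y \<le> R"
    and "0 < \<rho>" and wide: "prod_list (map r (map col v @ w)) \<le> prod_list (map a v) / \<rho>"
    and X: "X \<in> approx_square \<Lambda> v w" and Y: "Y \<in> approx_square \<Lambda> v w"
  shows "dist X Y \<le> R * (1 + (1 + max_slope) / \<rho>) * prod_list (map a v)"
proof -
  obtain x x' where x: "X = foldr (tgl_map a b d t) v x" "x \<in> \<Lambda>" "x' \<in> \<Lambda>"
      "x $ 1 = foldr (column_map r u) w (x' $ 1)"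
    using X by (auto simp: approx_square_def)
  obtain y y' where y: "Y = foldr (tgl_map a b d t) v y" "y \<in> \<Lambda>" "y' \<in> \<Lambda>"
      "y $ 1 = foldr (column_map r u) w (y' $ 1)"
    using Y by (auto simp: approx_square_def)
  have coord: "\<bar>p $ k - p' $ k\<bar> \<le> R" if "p \<in> \<Lambda>" "p' \<in> \<Lambda>" for p p' k
    using component_le_norm_cart[of "p - p'" k] R[OF that] by (simp add: dist_norm)
  have "0 \<le> R" using R[OF x(2) x(2)] by simp
  have cv: "set (map col v) \<subseteq> {1..M}" using v col_in by auto
  let ?r = "prod_list (map r (map col v))" and ?A = "prod_list (map a v)"
  have A: "0 \<le> ?A"
    using prod_list_powers_bounds[of v a 1] v a_bounds by (metis order_less_imp_le subsetD)
  have rv: "0 \<le> ?r"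
    using prod_list_powers_bounds[of "map col v" r 1] cv r_bounds by (metis order_less_imp_le subsetD)
  have rw: "0 \<le> prod_list (map r w)"
    using prod_list_powers_bounds[of w r 1] w r_bounds by (metis order_less_imp_le subsetD)
  have "?r * \<bar>x $ 1 - y $ 1\<bar> = ?r * (prod_list (map r w) * \<bar>x' $ 1 - y' $ 1\<bar>)"
    unfolding x y column_word_map_dist[OF w] ..
  also have "\<dots> \<le> ?r * (prod_list (map r w) * R)"
    using rv rw coord[OF x(3) y(3)] by (intro mult_left_mono) auto
  also have "\<dots> = prod_list (map r (map col v @ w)) * R" by simp
  also have "\<dots> \<le> ?A / \<rho> * R"
    using wide \<open>0 \<le> R\<close> by (rule mult_right_mono)
  finally have width: "?r * \<bar>x $ 1 - y $ 1\<bar> \<le> ?A / \<rho> * R" .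
  have "dist X Y \<le> \<bar>X $ 1 - Y $ 1\<bar> + \<bar>X $ 2 - Y $ 2\<bar>"
    using norm_le_l1_cart[of "X - Y"] by (simp add: dist_norm sum_2)
  moreover have "\<bar>X $ 1 - Y $ 1\<bar> = ?r * \<bar>x $ 1 - y $ 1\<bar>"
    unfolding x(1) y(1) word_map_1[OF v] by (rule column_word_map_dist[OF cv])
  moreover have "\<bar>X $ 2 - Y $ 2\<bar> \<le> ?A * R + max_slope * (?A / \<rho> * R)"
    using word_map_2_dist[OF v, of x y] mult_left_mono[OF coord[OF x(2) y(2), of 2] A]
      mult_left_mono[OF width max_slope_nonneg] by (simp add: x(1) y(1))
  ultimately have "dist X Y \<le> ?A / \<rho> * R + (?A * R + max_slope * (?A / \<rho> * R))"
    using width by linarith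
  then show ?thesis by (simp add: algebra_simps add_divide_distrib)
qed

lemma attractor_coding:
  assumes \<Lambda>: "is_attractor {1..N} (tgl_map a b d t) \<Lambda>" and x: "x \<in> \<Lambda>"
  shows "\<exists>\<iota>. (\<forall>k. \<iota> k \<in> {1..N}) \<and>
    (\<forall>L n. L \<le> n \<longrightarrow> x \<in> approx_square \<Lambda> (map \<iota> [0..<L]) (map (col \<circ> \<iota>) [L..<n]))"
proof -
  let ?f = "tgl_map a b d t"
  have "\<forall>y\<in>\<Lambda>. \<exists>i y'. i \<in> {1..N} \<and> y' \<in> \<Lambda> \<and> y = ?f i y'"
    using \<Lambda> unfolding is_attractor_def by blast
  then obtain I X where IX: "\<And>y. y \<in> \<Lambda> \<Longrightarrow> I y \<in> {1..N} \<and> X y \<in> \<Lambda> \<and> y = ?f (I y) (X y)"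
    by metis
  define orb where "orb k = (X ^^ k) x" for k
  define \<iota> where "\<iota> k = I (orb k)" for k
  have orb: "orb k \<in> \<Lambda>" for k
    using x IX by (induction k) (auto simp: orb_def)
  have orb_step: "orb k = ?f (\<iota> k) (orb (Suc k))" for k
    using IX[OF orb[of k]] by (simp add: \<iota>_def orb_def)
  have word: "orb j = foldr ?f (map \<iota> [j..<k]) (orb k)" if "j \<le> k" for j k
    using that
  proof (induction rule: dec_induct)
    case (step k)
    then show ?case using orb_step[of k] by simp
  qed simp
  show ?thesis
  proof (intro exI[of _ \<iota>] conjI allI impI)
    show \<iota>: "\<iota> k \<in> {1..N}" for k
      using IX[OF orb[of k]] by (simp add: \<iota>_def)
    fix L n :: nat assume "L \<le> n"
    have "set (map \<iota> [L..<n]) \<subseteq> {1..N}" using \<iota> by auto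
    from word_map_1[OF this, of "orb n"]
    have "orb L $ 1 = foldr (column_map r u) (map (col \<circ> \<iota>) [L..<n]) (orb n $ 1)"
      using word[OF \<open>L \<le> n\<close>] by simp
    moreover have "x = foldr ?f (map \<iota> [0..<L]) (orb L)"
      using word[of 0 L] by (simp add: orb_def)
    ultimately show "x \<in> approx_square \<Lambda> (map \<iota> [0..<L]) (map (col \<circ> \<iota>) [L..<n])"
      unfolding approx_square_def using orb by blast
  qed
qed

end

section \<open>Counting approximate squares by their empirical frequencies\<close>

context shifted_TGL
begin

lemma count_map_col:
  assumes "set v \<subseteq> {1..N}" "m \<in> {1..M}"
  shows "count_list (map col v) m = (\<Sum>j\<in>column Ns m. count_list v j)"
  using assms(1)
proof (induction v)
  case (Cons i v)
  have "i \<in> column Ns m \<longleftrightarrow> col i = m"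
    using Cons.prems in_column[OF assms(2)] col_in by auto
  moreover have "(\<Sum>j\<in>column Ns m. count_list (i # v) j) =
      (\<Sum>j\<in>column Ns m. (if j = i then 1 else 0) + count_list v j)"
    by (intro sum.cong) auto
  ultimately show ?case using Cons
    by (simp add: sum.distrib sum.delta' finite_column)
qed simp

lemma empirical_map_col:
  assumes "set v \<subseteq> {1..N}" "m \<in> {1..M}"
  shows "empirical (map col v) m = column_probs Ns (empirical v) m"
  by (simp add: empirical_def column_probs_def count_map_col[OF assms] sum_divide_distrib)

text \<open>The vector \<open>c\<close> matters only through its proportions within each column, and \<open>\<kappa>\<close> governs all the
  columns, including those of the maps in \<open>v\<close>. Thus the frequencies in \<open>v\<close> and those of the columns
  of the whole pair may be prescribed independently.\<close>

definition type_weight :: "(nat \<Rightarrow> real) \<Rightarrow> (nat \<Rightarrow> real) \<Rightarrow> nat list \<Rightarrow> nat list \<Rightarrow> real" where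
  "type_weight c \<kappa> v w = prod_list (map (\<lambda>i. c i / column_probs Ns c (col i)) v) *
     prod_list (map \<kappa> (map col v @ w))"

definition empirical_weight :: "nat list \<Rightarrow> nat list \<Rightarrow> real" where
  "empirical_weight v w = type_weight (empirical v) (empirical (map col v @ w)) v w"

definition word_pairs :: "nat \<Rightarrow> (nat list \<times> nat list) set" where
  "word_pairs n = (\<Union>L\<in>{..n}. words {1..N} L \<times> words {1..M} (n - L))"

lemma finite_word_pairs: "finite (word_pairs n)"
  by (simp add: word_pairs_def finite_words)

lemma type_weight_nonneg:
  assumes "\<And>i. i \<in> {1..N} \<Longrightarrow> 0 \<le> c i" "\<And>m. m \<in> {1..M} \<Longrightarrow> 0 \<le> \<kappa> m"
    "set v \<subseteq> {1..N}" "set w \<subseteq> {1..M}"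
  shows "0 \<le> type_weight c \<kappa> v w"
proof -
  have nonneg: "0 \<le> prod_list (map f z)" if "\<And>x. x \<in> set z \<Longrightarrow> 0 \<le> f x"
    for f :: "nat \<Rightarrow> real" and z
    using that by (induction z) auto
  have "0 \<le> c i / column_probs Ns c (col i)" if "i \<in> set v" for i
    using that assms(1,3) col_in column_probs_nonneg[of c "col i"] by (simp add: subset_iff)
  moreover have "0 \<le> \<kappa> m" if "m \<in> set (map col v @ w)" for m
    using that assms(2-4) col_in by (auto simp: subset_iff)
  ultimately show ?thesis
    unfolding type_weight_def by (intro mult_nonneg_nonneg nonneg)
qed

text \<open>For a probability vector \<open>\<kappa>\<close> on the columns, the weights are the cylinder masses of a Bernoulli
  measure: columns are drawn according to \<open>\<kappa>\<close>, and maps within a column proportionally to \<open>c\<close>. Mass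
  is lost only in columns on which \<open>c\<close> vanishes.\<close>

lemma sum_type_weight_le_1:
  assumes c: "\<And>i. i \<in> {1..N} \<Longrightarrow> 0 \<le> c i"
    and \<kappa>: "\<And>m. m \<in> {1..M} \<Longrightarrow> 0 \<le> \<kappa> m" "(\<Sum>m=1..M. \<kappa> m) = 1"
  shows "(\<Sum>(v, w)\<in>words {1..N} L \<times> words {1..M} l. type_weight c \<kappa> v w) \<le> 1"
proof -
  let ?C = "column_probs Ns c"
  have split: "type_weight c \<kappa> v w =
      prod_list (map (\<lambda>i. c i / ?C (col i) * \<kappa> (col i)) v) * prod_list (map \<kappa> w)" for v w
  proof -
    have "prod_list (map (\<lambda>i. c i / ?C (col i)) v) * prod_list (map \<kappa> (map col v)) =
        prod_list (map (\<lambda>i. c i / ?C (col i) * \<kappa> (col i)) v)"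
      by (induction v) (simp_all add: algebra_simps)
    then show ?thesis by (simp add: type_weight_def algebra_simps)
  qed
  have "(\<Sum>i=1..N. c i / ?C (col i) * \<kappa> (col i)) =
      (\<Sum>m=1..M. \<Sum>j\<in>column Ns m. c j / ?C m * \<kappa> m)"
    unfolding sum_columns by (intro sum.cong) (simp_all add: in_column)
  also have "\<dots> = (\<Sum>m=1..M. ?C m / ?C m * \<kappa> m)"
    by (simp only: column_probs_def sum_divide_distrib[symmetric] sum_distrib_right[symmetric])
  also have "\<dots> \<le> (\<Sum>m=1..M. \<kappa> m)"
    using \<kappa> by (intro sum_mono) auto
  finally have le1: "(\<Sum>i=1..N. c i / ?C (col i) * \<kappa> (col i)) \<le> 1" using \<kappa> by simp
  have "0 \<le> c i / ?C (col i) * \<kappa> (col i)" if "i \<in> {1..N}" for i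
    using that c \<kappa>(1) col_in column_probs_nonneg[of c "col i"] by simp
  then have ge0: "0 \<le> (\<Sum>i=1..N. c i / ?C (col i) * \<kappa> (col i))"
    by (rule sum_nonneg)
  have "(\<Sum>(v, w)\<in>words {1..N} L \<times> words {1..M} l. type_weight c \<kappa> v w) =
      (\<Sum>v\<in>words {1..N} L. prod_list (map (\<lambda>i. c i / ?C (col i) * \<kappa> (col i)) v)) *
      (\<Sum>w\<in>words {1..M} l. prod_list (map \<kappa> w))"
    by (simp add: split sum_product sum.cartesian_product)
  also have "\<dots> = (\<Sum>i=1..N. c i / ?C (col i) * \<kappa> (col i)) ^ L * 1 ^ l"
    using \<kappa>(2) by (simp add: sum_words_prod_list del: One_nat_def)
  also have "\<dots> \<le> 1"
    using power_le_one[OF ge0 le1] by simp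
  finally show ?thesis .
qed

text \<open>Each word pair is weighted by its own empirical frequencies. Polynomially many frequency vectors
  occur for words of total length \<open>n\<close>, and for each of them and each length of \<open>v\<close> the weights sum to
  at most \<open>1\<close>.\<close>

lemma sum_empirical_weight_le:
  assumes "0 < n"
  shows "(\<Sum>(v, w)\<in>word_pairs n. empirical_weight v w) \<le> real (n + 1) ^ (N + M + 1)"
proof -
  define T where "T = PiE {1..N} (\<lambda>_. {..n}) \<times> {k \<in> PiE {1..M} (\<lambda>_. {..n}). (\<Sum>m=1..M. k m) = n}"
  define tw where "tw = (\<lambda>(c, k). type_weight (\<lambda>i. real (c i)) (\<lambda>m. real (k m) / real n))"
    for ck :: "(nat \<Rightarrow> nat) \<times> (nat \<Rightarrow> nat)"
  have "finite T" by (simp add: T_def finite_PiE)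
  have pairs: "set v \<subseteq> {1..N}" "set w \<subseteq> {1..M}" "length v + length w = n" "length v \<le> n"
    if "(v, w) \<in> word_pairs n" for v w
    using that by (auto simp: word_pairs_def words_def)
  have tw_nonneg: "0 \<le> tw ck v w" if "set v \<subseteq> {1..N}" "set w \<subseteq> {1..M}" for ck v w
    using that by (auto simp: tw_def split: prod.split intro!: type_weight_nonneg)
  have "empirical_weight v w \<le> (\<Sum>ck\<in>T. tw ck v w)" if vw: "(v, w) \<in> word_pairs n" for v w
  proof -
    note vw' = pairs[OF vw]
    define z where "z = map col v @ w"
    have z: "set z \<subseteq> {1..M}" "length z = n" using vw' col_in by (auto simp: z_def)
    define c where "c = restrict (count_list v) {1..N}"
    define k where "k = restrict (count_list z) {1..M}"
    have "(\<Sum>m=1..M. k m) = n"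
    proof -
      have "(\<Sum>m=1..M. real (count_list z m) * 1) = real n"
        using sum_list_eq_sum_count[OF z(1), of "\<lambda>_. 1"] z(2) by (simp add: sum_list_triv)
      then have "real (\<Sum>m=1..M. count_list z m) = real n" by simp
      then show ?thesis by (simp only: of_nat_eq_iff) (simp add: k_def)
    qed
    moreover have "count_list v i \<le> n" "count_list z i \<le> n" for i
      using count_le_length[of v i] count_le_length[of z i] vw' z by auto
    ultimately have "(c, k) \<in> T"
      by (auto simp: T_def c_def k_def)
    have "empirical_weight v w = tw (c, k) v w"
    proof -
      have "empirical v i / column_probs Ns (empirical v) (col i) =
          real (c i) / column_probs Ns (\<lambda>i. real (c i)) (col i)" if i: "i \<in> set v" for i
      proof -
        have "length v \<noteq> 0" using i by auto
        have iN: "i \<in> {1..N}" using i vw' by auto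
        have "column_probs Ns (empirical v) (col i) =
            column_probs Ns (\<lambda>i. real (c i)) (col i) / real (length v)"
          unfolding column_probs_def sum_divide_distrib
          using in_column[OF col_in(1)[OF iN]]
          by (intro sum.cong) (auto simp: empirical_def c_def)
        then show ?thesis
          using iN \<open>length v \<noteq> 0\<close> by (simp add: empirical_def c_def)
      qed
      moreover have "empirical z m = real (k m) / real n" if "m \<in> set z" for m
        using that z by (auto simp: empirical_def k_def)
      ultimately show ?thesis
        unfolding empirical_weight_def tw_def type_weight_def z_def[symmetric] prod.case
        by (intro arg_cong2[where f = "(*)"] arg_cong[where f = prod_list] map_cong refl)
    qed
    also have "\<dots> \<le> (\<Sum>ck\<in>T. tw ck v w)"
      using \<open>(c, k) \<in> T\<close> \<open>finite T\<close> vw' tw_nonneg by (intro member_le_sum) auto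
    finally show ?thesis .
  qed
  then have "(\<Sum>(v, w)\<in>word_pairs n. empirical_weight v w) \<le>
      (\<Sum>(v, w)\<in>word_pairs n. \<Sum>ck\<in>T. tw ck v w)"
    by (intro sum_mono) auto
  also have "\<dots> = (\<Sum>ck\<in>T. \<Sum>(v, w)\<in>word_pairs n. tw ck v w)"
    unfolding case_prod_unfold by (rule sum.swap)
  also have "\<dots> \<le> (\<Sum>ck\<in>T. real (n + 1))"
  proof (rule sum_mono)
    fix ck assume "ck \<in> T"
    obtain c k where ck: "ck = (c, k)" by force
    then have "(\<Sum>m=1..M. k m) = n" using \<open>ck \<in> T\<close> by (auto simp: T_def)
    then have sum1: "(\<Sum>m=1..M. real (k m) / real n) = 1"
      using assms by (simp add: sum_divide_distrib[symmetric] of_nat_sum[symmetric]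
          del: of_nat_sum One_nat_def)
    have "(\<Sum>(v, w)\<in>word_pairs n. tw ck v w) =
        (\<Sum>L\<le>n. \<Sum>(v, w)\<in>words {1..N} L \<times> words {1..M} (n - L). tw ck v w)"
      unfolding word_pairs_def
      by (rule sum.UNION_disjoint) (auto simp: finite_words, auto simp: words_def)
    also have "\<dots> \<le> (\<Sum>L\<le>n. 1)"
      unfolding tw_def ck prod.case
      using sum1 by (intro sum_mono sum_type_weight_le_1) auto
    finally show "(\<Sum>(v, w)\<in>word_pairs n. tw ck v w) \<le> real (n + 1)" by simp
  qed
  also have "\<dots> = real (card T) * real (n + 1)" by simp
  also have "\<dots> \<le> real ((n + 1) ^ N * (n + 1) ^ M) * real (n + 1)"
  proof -
    have "card T \<le> card (PiE {1..N} (\<lambda>_. {..n}) \<times> PiE {1..M} (\<lambda>_. {..n}))"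
      unfolding T_def by (intro card_mono finite_cartesian_product finite_PiE) auto
    also have "\<dots> = (n + 1) ^ N * (n + 1) ^ M"
      by (simp add: card_cartesian_product card_PiE)
    finally show ?thesis
      by (intro mult_right_mono) (simp_all only: of_nat_le_iff of_nat_0_le_iff)
  qed
  also have "\<dots> = real (n + 1) ^ (N + M + 1)"
    by (simp add: power_add algebra_simps)
  finally show ?thesis .
qed

text \<open>Entropy of the column frequencies per unit of logarithmic contraction. For \<open>z = map col v\<close> this is
  the first summand of the functional at the empirical vector of \<open>v\<close>.\<close>

definition column_rate :: "nat list \<Rightarrow> real" where
  "column_rate z = (\<Sum>x\<leftarrow>z. ln (empirical z x)) / (\<Sum>x\<leftarrow>z. ln (r x))"

lemma sum_list_ln_neg:
  fixes f :: "'a \<Rightarrow> real"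
  assumes "z \<noteq> []" "\<And>x. x \<in> set z \<Longrightarrow> 0 < f x \<and> f x < 1"
  shows "(\<Sum>x\<leftarrow>z. ln (f x)) < 0"
  using assms
proof (induction z)
  case (Cons y z)
  have "0 < f y" "f y < 1" using Cons.prems(2)[of y] by auto
  then have "ln (f y) < 0" by simp
  moreover have "(\<Sum>x\<leftarrow>z. ln (f x)) \<le> 0"
  proof (cases "z = []")
    case False
    then have "(\<Sum>x\<leftarrow>z. ln (f x)) < 0"
      using Cons.prems(2) by (intro Cons.IH) auto
    then show ?thesis by simp
  qed simp
  ultimately show ?case by simp
qed simp

lemma column_rate_bounds:
  assumes "z \<noteq> []" "set z \<subseteq> {1..M}" and \<sigma>: "\<And>m. m \<in> {1..M} \<Longrightarrow> r m \<le> \<sigma>" "0 < \<sigma>" "\<sigma> < 1"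
  shows "0 \<le> column_rate z" "column_rate z \<le> M / (- ln \<sigma>)"
proof -
  define h where "h = - (\<Sum>m=1..M. empirical z m * ln (empirical z m))"
  define l where "l = - (\<Sum>m=1..M. empirical z m * ln (r m))"
  have sum1: "(\<Sum>m=1..M. empirical z m) = 1"
    using assms by (intro sum_empirical) auto
  have e: "0 \<le> empirical z m" "empirical z m \<le> 1" if "m \<in> {1..M}" for m
    using that sum1 member_le_sum[of m "{1..M}" "empirical z"]
    by (auto simp: empirical_nonneg simp del: One_nat_def)
  have rate: "column_rate z = h / l"
    using assms sum_list_eq_sum_empirical[OF assms(2), of "\<lambda>x. ln (empirical z x)"]
      sum_list_eq_sum_empirical[OF assms(2), of "\<lambda>x. ln (r x)"]
    by (simp add: column_rate_def h_def l_def)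
  have "h \<le> (\<Sum>m=1..M. 1)"
    unfolding h_def sum_negf[symmetric] using e by (intro sum_mono minus_x_ln_x_bounds)
  then have "h \<le> M" by simp
  have "0 \<le> h"
    unfolding h_def sum_negf[symmetric] using e by (intro sum_nonneg minus_x_ln_x_bounds)
  have "(\<Sum>m=1..M. empirical z m * ln (r m)) \<le> (\<Sum>m=1..M. empirical z m * ln \<sigma>)"
    using e \<sigma> r_bounds by (intro sum_mono mult_left_mono) auto
  also have "\<dots> = ln \<sigma>" by (simp only: sum_distrib_right[symmetric] sum1)
  finally have "- ln \<sigma> \<le> l" by (simp add: l_def)
  moreover have "0 < - ln \<sigma>" using \<sigma> by simp
  ultimately show "0 \<le> column_rate z" "column_rate z \<le> M / (- ln \<sigma>)"
    unfolding rate using frac_le[OF _ \<open>h \<le> M\<close>, of "- ln \<sigma>" l] \<open>0 \<le> h\<close> by auto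
qed

text \<open>Let \<open>x\<close> be minus the logarithm of the height of the cylinder of \<open>v\<close>. In the logarithm of the
  empirical weight, the choices within columns contribute \<open>- x\<close> times the second summand of the
  functional at the empirical vector of \<open>v\<close>. The column choices contribute the column rate of
  \<open>map col v @ w\<close> times the logarithm of a column width, which is at least \<open>- x\<close>; by the condition on
  the rates, this is at least \<open>- x\<close> times the first summand plus \<open>\<epsilon>\<close>.\<close>

lemma empirical_weight_ge:
  assumes "v \<noteq> []" and v: "set v \<subseteq> {1..N}" and w: "set w \<subseteq> {1..M}" and "0 < \<epsilon>"
    and \<alpha>: "\<And>p. p \<in> prob_vectors N \<Longrightarrow> dim_functional N M Ns a b p \<le> \<alpha>"
    and narrow: "prod_list (map a v) \<le> prod_list (map r (map col v @ w))"
    and rate: "column_rate (map col v @ w) \<le> column_rate (map col v) + \<epsilon>"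
  shows "prod_list (map a v) powr (\<alpha> + \<epsilon>) \<le> empirical_weight v w"
proof -
  define p where "p = empirical v"
  define q where "q = column_probs Ns p"
  define z where "z = map col v @ w"
  have z: "set z \<subseteq> {1..M}" "z \<noteq> []" using v w col_in \<open>v \<noteq> []\<close> by (auto simp: z_def)
  have cv: "set (map col v) \<subseteq> {1..M}" "map col v \<noteq> []" using v col_in \<open>v \<noteq> []\<close> by auto
  have q: "empirical (map col v) m = q m" if "m \<in> {1..M}" for m
    using empirical_map_col[OF v that] by (simp add: q_def p_def)
  have q_pos: "0 < q (col i)" if "i \<in> set v" for i
    using empirical_pos[of "col i" "map col v"] q[of "col i"] cv that by auto
  define P where "P = (\<Sum>i\<leftarrow>v. ln (p i))"
  define Q where "Q = (\<Sum>x\<leftarrow>map col v. ln (q x))"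
  define Z where "Z = (\<Sum>x\<leftarrow>z. ln (empirical z x))"
  define A where "A = (\<Sum>i\<leftarrow>v. ln (a i))"
  define B where "B = (\<Sum>x\<leftarrow>map col v. ln (r x))"
  define R where "R = (\<Sum>x\<leftarrow>z. ln (r x))"
  have prob: "p \<in> prob_vectors N"
    using sum_empirical[OF v _ \<open>v \<noteq> []\<close>] by (auto simp: p_def prob_vectors_def empirical_nonneg)
  have "A < 0" "R < 0"
    using sum_list_ln_neg[of v a] sum_list_ln_neg[of z r] z v \<open>v \<noteq> []\<close> a_bounds r_bounds
    by (auto simp: A_def R_def subset_iff)
  have "A \<le> R"
  proof -
    have "0 < prod_list (map a v)" "ln (prod_list (map a v)) = A"
      using ln_prod_list[of v a] v a_bounds by (auto simp: A_def subset_iff)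
    moreover have "0 < prod_list (map r z)" "ln (prod_list (map r z)) = R"
      using ln_prod_list[of z r] z r_bounds by (auto simp: R_def subset_iff)
    ultimately show ?thesis using narrow by (metis ln_le_cancel_iff z_def)
  qed
  have D: "dim_functional N M Ns a b p = Q / B + (P - Q) / A"
  proof -
    have nonneg: "\<And>i. i \<in> {1..N} \<Longrightarrow> 0 \<le> p i" by (simp add: p_def empirical_nonneg)
    define len where "len = real (length v)"
    have "len \<noteq> 0" using \<open>v \<noteq> []\<close> by (simp add: len_def)
    have Q: "Q = len * (\<Sum>m=1..M. q m * ln (q m))"
      unfolding Q_def sum_list_eq_sum_empirical[OF cv(1) finite_atLeastAtMost]
      by (simp add: q len_def del: One_nat_def)
    have B: "B = len * (\<Sum>i=1..N. p i * ln (b i))"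
    proof -
      have "B = (\<Sum>i\<leftarrow>v. ln (b i))"
        unfolding B_def using v by (auto simp: b_eq subset_iff intro!: arg_cong[where f = sum_list])
      then show ?thesis
        unfolding sum_list_eq_sum_empirical[OF v finite_atLeastAtMost] p_def len_def .
    qed
    have PA: "P = len * (\<Sum>i=1..N. p i * ln (p i))" "A = len * (\<Sum>i=1..N. p i * ln (a i))"
      unfolding P_def A_def sum_list_eq_sum_empirical[OF v finite_atLeastAtMost] p_def len_def
      by (rule refl)+
    have "dim_functional N M Ns a b p = (\<Sum>m=1..M. q m * ln (q m)) / (\<Sum>i=1..N. p i * ln (b i)) +
      ((\<Sum>i=1..N. p i * ln (p i)) - (\<Sum>m=1..M. q m * ln (q m))) / (\<Sum>i=1..N. p i * ln (a i))"
      unfolding q_def by (rule dim_functional_eq) (rule nonneg)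
    then show ?thesis
      unfolding Q B PA right_diff_distrib[symmetric] using \<open>len \<noteq> 0\<close> by simp
  qed
  have rates: "column_rate z = Z / R" "column_rate (map col v) = Q / B"
  proof -
    show "column_rate z = Z / R" by (simp add: column_rate_def Z_def R_def)
    have "(\<Sum>x\<leftarrow>map col v. ln (empirical (map col v) x)) = Q"
      unfolding Q_def by (intro arg_cong[where f = sum_list] map_cong refl) (use q cv in auto)
    then show "column_rate (map col v) = Q / B" by (simp add: column_rate_def B_def)
  qed
  have W: "0 < empirical_weight v w" "ln (empirical_weight v w) = P - Q + Z"
  proof -
    have 1: "0 < prod_list (map (\<lambda>i. p i / q (col i)) v)"
      "ln (prod_list (map (\<lambda>i. p i / q (col i)) v)) = (\<Sum>i\<leftarrow>v. ln (p i / q (col i)))"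
      using ln_prod_list[of v "\<lambda>i. p i / q (col i)"] q_pos by (auto simp: p_def empirical_pos)
    have 2: "0 < prod_list (map (empirical z) z)" "ln (prod_list (map (empirical z) z)) = Z"
      using ln_prod_list[of z "empirical z"] by (auto simp: empirical_pos Z_def)
    have "(\<Sum>i\<leftarrow>v. ln (p i / q (col i))) = (\<Sum>i\<leftarrow>v. ln (p i) - ln (q (col i)))"
      by (intro arg_cong[where f = sum_list] map_cong refl ln_divide_pos q_pos)
        (simp_all add: p_def empirical_pos)
    also have "\<dots> = P - Q"
      by (simp add: P_def Q_def sum_list_subtractf o_def)
    finally show "0 < empirical_weight v w" "ln (empirical_weight v w) = P - Q + Z"
      using 1 2 by (simp_all add: empirical_weight_def type_weight_def ln_mult_pos
          p_def[symmetric] q_def[symmetric] z_def[symmetric])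
  qed
  have "0 \<le> Z / R"
  proof -
    define \<sigma> where "\<sigma> = Max (r ` {1..M})"
    have "\<sigma> \<in> r ` {1..M}" unfolding \<sigma>_def using M_gt_1 by (intro Max_in) auto
    moreover have "r m \<le> \<sigma>" if "m \<in> {1..M}" for m unfolding \<sigma>_def using that by (intro Max_ge) auto
    ultimately show ?thesis
      using column_rate_bounds(1)[OF z(2,1), of \<sigma>] r_bounds rates(1) by (metis imageE)
  qed
  have "(\<alpha> + \<epsilon>) * A \<le> (Q / B + (P - Q) / A + \<epsilon>) * A"
    using \<alpha>[OF prob] D \<open>A < 0\<close> by (intro mult_right_mono_neg) auto
  also have "\<dots> = P - Q + (Q / B + \<epsilon>) * A"
    using \<open>A < 0\<close> by (simp add: distrib_right)
  also have "\<dots> \<le> P - Q + Z / R * A"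
    using rate rates \<open>A < 0\<close>
    by (intro add_left_mono mult_right_mono_neg) (auto simp: z_def)
  also have "\<dots> \<le> P - Q + Z / R * R"
    using \<open>0 \<le> Z / R\<close> \<open>A \<le> R\<close> by (intro add_left_mono mult_left_mono)
  also have "\<dots> = ln (empirical_weight v w)"
    using W \<open>R < 0\<close> by simp
  finally have "exp ((\<alpha> + \<epsilon>) * A) \<le> empirical_weight v w"
    using W(1) by (simp add: ln_ge_iff)
  then show ?thesis
    using ln_prod_list[of v a] v a_bounds by (auto simp: powr_def A_def subset_iff)
qed

end

section \<open>Good scales\<close>

context shifted_TGL
begin

text \<open>Let \<open>n\<close> be the largest number of columns whose cylinder is at least as wide as the cylinder of the
  first \<open>L\<close> maps is high. If the column rate grew by more than \<open>\<epsilon>\<close> from \<open>L\<close> to \<open>n\<close> for every large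
  \<open>L\<close>, iterating \<open>L \<mapsto> n\<close> would make it unbounded; but column rates are bounded.\<close>

lemma good_scale:
  assumes \<iota>: "\<And>k. \<iota> k \<in> {1..N}" and "0 < \<epsilon>"
    and \<rho>: "\<And>m. m \<in> {1..M} \<Longrightarrow> \<rho> \<le> r m" "0 < \<rho>"
    and \<sigma>: "\<And>m. m \<in> {1..M} \<Longrightarrow> r m \<le> \<sigma>" "0 < \<sigma>" "\<sigma> < 1"
  shows "\<exists>L n. L\<^sub>0 \<le> L \<and> L \<le> n \<and>
    prod_list (map a (map \<iota> [0..<L])) \<le> prod_list (map r (map (col \<circ> \<iota>) [0..<n])) \<and>
    prod_list (map r (map (col \<circ> \<iota>) [0..<n])) \<le> prod_list (map a (map \<iota> [0..<L])) / \<rho> \<and>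
    column_rate (map (col \<circ> \<iota>) [0..<n]) \<le> column_rate (map (col \<circ> \<iota>) [0..<L]) + \<epsilon>"
proof -
  define H where "H L = prod_list (map a (map \<iota> [0..<L]))" for L
  define z where "z n = map (col \<circ> \<iota>) [0..<n]" for n
  define W where "W n = prod_list (map r (z n))" for n
  have z: "set (z n) \<subseteq> {1..M}" "length (z n) = n" for n
    using \<iota> col_in by (auto simp: z_def)
  have H_Suc: "H (Suc n) = H n * a (\<iota> n)" and W_Suc: "W (Suc n) = W n * r (col (\<iota> n))" for n
    by (simp_all add: H_def W_def z_def)
  have HW: "0 < H n \<and> H n \<le> W n" for n
  proof (induction n)
    case 0
    show ?case by (simp add: H_def W_def z_def)
  next
    case (Suc n)
    have "0 < a (\<iota> n)" "a (\<iota> n) \<le> r (col (\<iota> n))"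
      using contraction[OF \<iota>[of n]] b_eq[OF \<iota>[of n]] by auto
    then show ?case
      unfolding H_Suc W_Suc using Suc by (auto intro!: mult_mono)
  qed
  have W_le: "W n \<le> \<sigma> ^ n" for n
    using prod_list_powers_bounds[of "z n" r \<sigma>] z r_bounds \<sigma>(1)
    by (auto simp: W_def subset_iff less_imp_le)
  have "\<exists>n\<ge>L. H L \<le> W n \<and> W n \<le> H L / \<rho>" for L
  proof -
    have "(\<lambda>n. \<sigma> ^ n) \<longlonglongrightarrow> 0"
      using \<sigma> by (intro LIMSEQ_power_zero) simp
    then have "(\<lambda>n. \<sigma> ^ (n + L)) \<longlonglongrightarrow> 0"
      by (rule LIMSEQ_ignore_initial_segment)
    then have "\<forall>\<^sub>F n in sequentially. \<sigma> ^ (n + L) < H L"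
      using HW by (intro order_tendstoD) auto
    then obtain k where "\<sigma> ^ (k + L) < H L" by (auto simp: eventually_sequentially)
    then have "W (L + k) < H L" using W_le[of "L + k"] by (simp add: add.commute)
    moreover have "\<not> W (L + 0) < H L" using HW[of L] by simp
    ultimately obtain j where j: "\<not> W (L + j) < H L" "W (L + Suc j) < H L"
      using ex_least_nat_less[of "\<lambda>k. W (L + k) < H L" k] by auto
    have "W (L + j) * \<rho> \<le> W (L + Suc j)"
      using W_Suc[of "L + j"] \<rho>(1)[OF col_in(1)[OF \<iota>[of "L + j"]]] HW[of "L + j"]
      by (simp add: mult_left_mono)
    then have "W (L + j) \<le> H L / \<rho>"
      using j(2) \<rho>(2) by (simp add: pos_le_divide_eq)
    then show ?thesis using j(1) by (intro exI[of _ "L + j"]) auto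
  qed
  then obtain nxt where nxt: "\<And>L. L \<le> nxt L \<and> H L \<le> W (nxt L) \<and> W (nxt L) \<le> H L / \<rho>"
    by metis
  have "\<exists>L\<ge>L\<^sub>0. column_rate (z (nxt L)) \<le> column_rate (z L) + \<epsilon>"
  proof (rule ccontr)
    assume "\<not> ?thesis"
    then have grow: "column_rate (z L) + \<epsilon> < column_rate (z (nxt L))" if "L\<^sub>0 \<le> L" for L
      using that by force
    have bounds: "0 \<le> column_rate (z L)" "column_rate (z L) \<le> M / (- ln \<sigma>)" if "0 < L" for L
    proof -
      have "z L \<noteq> []" using that by (simp add: z_def)
      then show "0 \<le> column_rate (z L)" "column_rate (z L) \<le> M / (- ln \<sigma>)"
        using column_rate_bounds[OF _ z(1) \<sigma>] by simp_all
    qed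
    have "\<exists>L\<ge>max 1 L\<^sub>0. real k * \<epsilon> \<le> column_rate (z L)" for k
    proof (induction k)
      case 0
      show ?case using bounds(1)[of "max 1 L\<^sub>0"] by (intro exI[of _ "max 1 L\<^sub>0"]) auto
    next
      case (Suc k)
      then obtain L where L: "max 1 L\<^sub>0 \<le> L" "real k * \<epsilon> \<le> column_rate (z L)" by blast
      then have "real (Suc k) * \<epsilon> \<le> column_rate (z (nxt L))"
        using grow[of L] by (simp add: algebra_simps)
      then show ?case using L(1) nxt[of L] by (intro exI[of _ "nxt L"]) auto
    qed
    moreover obtain k where "M / (- ln \<sigma>) < real k * \<epsilon>"
      using \<open>0 < \<epsilon>\<close> reals_Archimedean3 by blast
    ultimately obtain L where "1 \<le> L" "M / (- ln \<sigma>) < column_rate (z L)"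
      by (meson max.boundedE order_less_le_trans)
    then show False using bounds(2)[of L] by simp
  qed
  then obtain L where "L\<^sub>0 \<le> L" "column_rate (z (nxt L)) \<le> column_rate (z L) + \<epsilon>" by blast
  then show ?thesis
    using nxt[of L] unfolding H_def W_def z_def by blast
qed

end

section \<open>The upper bound for the Hausdorff dimension\<close>

lemma poly_geometric_tails:
  fixes c \<theta> \<eta> :: real
  assumes "0 < \<theta>" "\<theta> < 1" "0 < \<eta>"
  shows "\<exists>n\<^sub>0. \<forall>m\<ge>n\<^sub>0. \<forall>n. (\<Sum>k=m..<n. c * (\<theta> ^ k * real (k + 1) ^ K)) \<le> \<eta>"
proof -
  define f where "f k = \<theta> ^ k * real (k + 1) ^ K" for k
  have "(\<lambda>k. \<theta> * (1 + inverse (real (Suc k))) ^ K) \<longlonglongrightarrow> \<theta> * (1 + 0) ^ K"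
    by (intro tendsto_intros LIMSEQ_inverse_real_of_nat)
  then have "\<forall>\<^sub>F k in sequentially. \<theta> * (1 + inverse (real (Suc k))) ^ K < (1 + \<theta>) / 2"
    using assms by (intro order_tendstoD(2)) auto
  then obtain k\<^sub>0 where k\<^sub>0: "\<And>k. k\<^sub>0 \<le> k \<Longrightarrow> \<theta> * (1 + inverse (real (Suc k))) ^ K < (1 + \<theta>) / 2"
    by (auto simp: eventually_sequentially)
  have "summable f"
  proof (rule summable_ratio_test[of "(1 + \<theta>) / 2" k\<^sub>0])
    fix k assume "k\<^sub>0 \<le> k"
    have "real (Suc k + 1) = (1 + inverse (real (Suc k))) * real (k + 1)"
      by (simp add: field_simps)
    then have "f (Suc k) = \<theta> * (1 + inverse (real (Suc k))) ^ K * f k"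
      by (simp only: f_def power_mult_distrib) simp
    also have "\<dots> \<le> (1 + \<theta>) / 2 * f k"
      using k\<^sub>0[OF \<open>k\<^sub>0 \<le> k\<close>] assms by (intro mult_right_mono) (auto simp: f_def)
    finally show "norm (f (Suc k)) \<le> (1 + \<theta>) / 2 * norm (f k)"
      using assms by (simp add: f_def)
  qed (use assms in auto)
  then have "summable (\<lambda>k. c * f k)" by (rule summable_mult)
  then obtain n\<^sub>0 where n\<^sub>0: "\<And>m n. n\<^sub>0 \<le> m \<Longrightarrow> norm (\<Sum>k=m..<n. c * f k) < \<eta>"
    using \<open>0 < \<eta>\<close> unfolding summable_Cauchy by blast
  have "(\<Sum>k=m..<n. c * f k) \<le> \<eta>" if "n\<^sub>0 \<le> m" for m n
    using n\<^sub>0[OF that, of n] by simp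
  then show ?thesis unfolding f_def by blast
qed

context shifted_TGL
begin

text \<open>By \<open>good_scale\<close>, the attractor is covered by arbitrarily small approximate squares that satisfy
  the column rate condition. Their diameters to the power \<open>\<alpha> + \<epsilon>\<close> are dominated by the empirical weights, whose sum
  over one generation grows polynomially; the second \<open>\<epsilon>\<close> in the exponent contributes a geometric
  factor that outweighs this growth.\<close>

lemma hausdorff_measure_attractor_0:
  assumes \<Lambda>: "is_attractor {1..N} (tgl_map a b d t) \<Lambda>"
    and \<alpha>: "\<And>p. p \<in> prob_vectors N \<Longrightarrow> dim_functional N M Ns a b p \<le> \<alpha>"
    and "0 \<le> \<alpha>" "0 < \<epsilon>"
  shows "hausdorff_measure (\<alpha> + 2 * \<epsilon>) \<Lambda> = 0"
proof (rule hausdorff_measure_eq_0I[where U = "\<lambda>(v, w). approx_square \<Lambda> v w"])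
  fix \<delta> \<eta> :: real assume "0 < \<delta>" "0 < \<eta>"
  define \<rho> where "\<rho> = Min (r ` {1..M})"
  define \<sigma> where "\<sigma> = Max (r ` {1..M})"
  have "\<rho> \<in> r ` {1..M}" "\<sigma> \<in> r ` {1..M}"
    unfolding \<rho>_def \<sigma>_def using M_gt_1 by (auto intro!: Min_in Max_in)
  then have pos: "0 < \<rho>" "0 < \<sigma>" "\<sigma> < 1" using r_bounds by auto
  have \<rho>: "\<And>m. m \<in> {1..M} \<Longrightarrow> \<rho> \<le> r m" and \<sigma>: "\<And>m. m \<in> {1..M} \<Longrightarrow> r m \<le> \<sigma>"
    by (auto simp: \<rho>_def \<sigma>_def)
  have "bounded \<Lambda>" using \<Lambda> by (auto simp: is_attractor_def compact_imp_bounded)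
  then obtain R where R: "\<And>x y. x \<in> \<Lambda> \<Longrightarrow> y \<in> \<Lambda> \<Longrightarrow> dist x y \<le> R"
    by (auto simp: bounded_two_points)
  obtain x\<^sub>0 where "x\<^sub>0 \<in> \<Lambda>" using \<Lambda> by (auto simp: is_attractor_def)
  then have "0 \<le> R" using R[of x\<^sub>0 x\<^sub>0] by simp
  define c where "c = R * (1 + (1 + max_slope) / \<rho>)"
  have "0 \<le> c"
    using \<open>0 \<le> R\<close> pos max_slope_nonneg by (simp add: c_def)
  define s where "s = \<alpha> + 2 * \<epsilon>"
  have "0 < s" using \<open>0 \<le> \<alpha>\<close> \<open>0 < \<epsilon>\<close> by (simp add: s_def)
  define \<theta> where "\<theta> = \<sigma> powr \<epsilon>"
  have \<theta>: "0 < \<theta>" "\<theta> < 1"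
    using pos \<open>0 < \<epsilon>\<close> powr_less_mono'[of \<sigma> 0 \<epsilon>] by (auto simp: \<theta>_def)
  obtain n\<^sub>1 where n\<^sub>1: "\<And>m n. n\<^sub>1 \<le> m \<Longrightarrow>
      (\<Sum>k=m..<n. c powr s * (\<theta> ^ k * real (k + 1) ^ (N + M + 1))) \<le> \<eta>"
    using poly_geometric_tails[OF \<theta> \<open>0 < \<eta>\<close>] by blast
  have "(\<lambda>n. c * \<sigma> ^ n) \<longlonglongrightarrow> c * 0"
    using pos by (intro tendsto_intros LIMSEQ_power_zero) simp
  then have "\<forall>\<^sub>F n in sequentially. c * \<sigma> ^ n < \<delta>"
    using \<open>0 < \<delta>\<close> by (intro order_tendstoD) auto
  then obtain n\<^sub>2 where n\<^sub>2: "\<And>n. n\<^sub>2 \<le> n \<Longrightarrow> c * \<sigma> ^ n < \<delta>"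
    unfolding eventually_sequentially by blast
  \<comment> \<open>Positive, because empirical frequencies are only meaningful for nonempty words.\<close>
  define n\<^sub>0 where "n\<^sub>0 = max 1 (max n\<^sub>1 n\<^sub>2)"
  define C where "C = {(v, w). set v \<subseteq> {1..N} \<and> set w \<subseteq> {1..M} \<and> n\<^sub>0 \<le> length v \<and>
    prod_list (map a v) \<le> prod_list (map r (map col v @ w)) \<and>
    prod_list (map r (map col v @ w)) \<le> prod_list (map a v) / \<rho> \<and>
    column_rate (map col v @ w) \<le> column_rate (map col v) + \<epsilon>}"
  have cover: "\<exists>(v, w)\<in>C. x \<in> approx_square \<Lambda> v w" if "x \<in> \<Lambda>" for x
  proof -
    obtain \<iota> where \<iota>: "\<And>k. \<iota> k \<in> {1..N}"
      and mem: "\<And>L n. L \<le> n \<Longrightarrow> x \<in> approx_square \<Lambda> (map \<iota> [0..<L]) (map (col \<circ> \<iota>) [L..<n])"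
      using attractor_coding[OF \<Lambda> \<open>x \<in> \<Lambda>\<close>] by blast
    obtain L n where L: "n\<^sub>0 \<le> L" "L \<le> n"
      "prod_list (map a (map \<iota> [0..<L])) \<le> prod_list (map r (map (col \<circ> \<iota>) [0..<n]))"
      "prod_list (map r (map (col \<circ> \<iota>) [0..<n])) \<le> prod_list (map a (map \<iota> [0..<L])) / \<rho>"
      "column_rate (map (col \<circ> \<iota>) [0..<n]) \<le> column_rate (map (col \<circ> \<iota>) [0..<L]) + \<epsilon>"
      using good_scale[where \<iota> = \<iota> and L\<^sub>0 = n\<^sub>0, OF \<iota> \<open>0 < \<epsilon>\<close> \<rho> pos(1) \<sigma> pos(2,3)] by blast
    define v where "v = map \<iota> [0..<L]"
    define w where "w = map (col \<circ> \<iota>) [L..<n]"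
    have "[0..<n] = [0..<L] @ [L..<n]"
      using upt_add_eq_append[of 0 L "n - L"] \<open>L \<le> n\<close> by simp
    then have z: "map (col \<circ> \<iota>) [0..<n] = map col v @ w" "map (col \<circ> \<iota>) [0..<L] = map col v"
      by (simp_all add: v_def w_def)
    have "set v \<subseteq> {1..N}" "set w \<subseteq> {1..M}" "length v = L"
      using \<iota> col_in(1)[OF \<iota>] by (auto simp: v_def w_def)
    then have "(v, w) \<in> C"
      using L unfolding z v_def[symmetric] by (simp add: C_def)
    moreover have "x \<in> approx_square \<Lambda> v w"
      using mem[OF \<open>L \<le> n\<close>] by (simp add: v_def w_def)
    ultimately show ?thesis by blast
  qed
  have small: "bounded (approx_square \<Lambda> v w) \<and> diameter (approx_square \<Lambda> v w) \<le> \<delta> \<and>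
      diam_pow s (approx_square \<Lambda> v w) \<le> c powr s * \<theta> ^ (length v + length w) * empirical_weight v w"
    if "(v, w) \<in> C" for v w
  proof -
    define A where "A = prod_list (map a v)"
    let ?S = "approx_square \<Lambda> v w" and ?n = "length v + length w"
    have vw: "set v \<subseteq> {1..N}" "set w \<subseteq> {1..M}" "v \<noteq> []" "n\<^sub>2 \<le> ?n"
      and A_le: "A \<le> prod_list (map r (map col v @ w))"
      and wide: "prod_list (map r (map col v @ w)) \<le> A / \<rho>"
      and rate: "column_rate (map col v @ w) \<le> column_rate (map col v) + \<epsilon>"
      using that by (auto simp: C_def n\<^sub>0_def A_def)
    have "0 < A"
      using ln_prod_list[of v a] vw a_bounds by (auto simp: A_def subset_iff)
    have z: "set (map col v @ w) \<subseteq> {1..M}" using vw col_in by auto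
    have "prod_list (map r (map col v @ w)) \<le> \<sigma> ^ length (map col v @ w)"
      using prod_list_powers_bounds[of "map col v @ w" r \<sigma>] z r_bounds \<sigma>
      by (meson less_imp_le subsetD)
    then have A_le_\<sigma>: "A \<le> \<sigma> ^ ?n" using A_le by simp
    have dist: "dist X Y \<le> c * A" if "X \<in> ?S" "Y \<in> ?S" for X Y
      using approx_square_dist[OF vw(1,2) R pos(1) _ that] wide by (simp add: c_def A_def)
    have "bounded ?S"
      unfolding bounded_def using dist by blast
    have diam: "diameter ?S \<le> c * A"
      using dist \<open>0 \<le> c\<close> \<open>0 < A\<close> by (intro diameter_le) (auto simp: dist_norm)
    have "c * A \<le> c * \<sigma> ^ ?n" using A_le_\<sigma> \<open>0 \<le> c\<close> by (rule mult_left_mono)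
    then have "diameter ?S \<le> \<delta>" using diam n\<^sub>2[OF vw(4)] by linarith
    have "diam_pow s ?S \<le> (c * A) powr s"
      using diam \<open>0 < s\<close> diameter_ge_0[OF \<open>bounded ?S\<close>]
      by (auto simp: diam_pow_def intro!: powr_mono2)
    also have "\<dots> = c powr s * (A powr \<epsilon> * A powr (\<alpha> + \<epsilon>))"
      using \<open>0 < A\<close> by (simp add: powr_mult powr_add[symmetric] s_def algebra_simps)
    also have "\<dots> \<le> c powr s * (\<theta> ^ ?n * empirical_weight v w)"
    proof (intro mult_left_mono mult_mono)
      have "A powr \<epsilon> \<le> (\<sigma> ^ ?n) powr \<epsilon>"
        using A_le_\<sigma> \<open>0 < A\<close> \<open>0 < \<epsilon>\<close> by (intro powr_mono2) auto
      also have "\<dots> = \<theta> ^ ?n"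
        using pos by (simp add: \<theta>_def powr_realpow[symmetric] powr_powr mult.commute)
      finally show "A powr \<epsilon> \<le> \<theta> ^ ?n" .
      show "A powr (\<alpha> + \<epsilon>) \<le> empirical_weight v w"
        unfolding A_def
        by (rule empirical_weight_ge[OF vw(3,1,2) \<open>0 < \<epsilon>\<close> \<alpha> A_le[unfolded A_def] rate])
    qed (use \<theta> in auto)
    finally show ?thesis
      using \<open>bounded ?S\<close> \<open>diameter ?S \<le> \<delta>\<close> by (simp add: mult.assoc)
  qed
  have "(\<Sum>(v, w)\<in>F. diam_pow s (approx_square \<Lambda> v w)) \<le> \<eta>" if F: "finite F" "F \<subseteq> C" for F
  proof -
    let ?g = "\<lambda>(v, w). c powr s * \<theta> ^ (length v + length w) * empirical_weight v w"
    \<comment> \<open>A crude strict upper bound for the total lengths that occur in \<open>F\<close>.\<close>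
    define n where "n = Suc (\<Sum>(v, w)\<in>F. length v + length w)"
    have g_nonneg: "0 \<le> ?g (v, w)" if "set v \<subseteq> {1..N}" "set w \<subseteq> {1..M}" for v w
      using that \<theta> type_weight_nonneg[of "empirical v" "empirical (map col v @ w)" v w]
      by (simp add: empirical_weight_def empirical_nonneg)
    have "(\<Sum>(v, w)\<in>F. diam_pow s (approx_square \<Lambda> v w)) \<le> sum ?g F"
      using F(2) small by (intro sum_mono) auto
    also have "\<dots> \<le> sum ?g (\<Union>k\<in>{n\<^sub>0..<n}. word_pairs k)"
    proof (rule sum_mono2)
      show "F \<subseteq> (\<Union>k\<in>{n\<^sub>0..<n}. word_pairs k)"
      proof
        fix x assume "x \<in> F"
        obtain v w where x: "x = (v, w)" by force
        have "length v + length w < n"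
          using member_le_sum[OF \<open>x \<in> F\<close>, of "\<lambda>(v, w). length v + length w"] F(1)
          by (simp add: n_def x)
        moreover have "set v \<subseteq> {1..N}" "set w \<subseteq> {1..M}" "n\<^sub>0 \<le> length v"
          using \<open>x \<in> F\<close> F(2) by (auto simp: C_def x)
        ultimately show "x \<in> (\<Union>k\<in>{n\<^sub>0..<n}. word_pairs k)"
          unfolding x word_pairs_def words_def
          by (intro UN_I[of "length v + length w"] UN_I[of "length v"]) auto
      qed
      show "0 \<le> ?g x" if "x \<in> (\<Union>k\<in>{n\<^sub>0..<n}. word_pairs k) - F" for x
        using that g_nonneg by (auto simp: word_pairs_def words_def)
    qed (simp add: finite_word_pairs)
    also have "\<dots> = (\<Sum>k=n\<^sub>0..<n. sum ?g (word_pairs k))"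
      by (intro sum.UNION_disjoint ballI impI finite_word_pairs)
        (auto simp: word_pairs_def words_def)
    also have "\<dots> \<le> (\<Sum>k=n\<^sub>0..<n. c powr s * (\<theta> ^ k * real (k + 1) ^ (N + M + 1)))"
    proof (rule sum_mono)
      fix k assume "k \<in> {n\<^sub>0..<n}"
      then have "0 < k" by (auto simp: n\<^sub>0_def)
      have "sum ?g (word_pairs k) = (\<Sum>(v, w)\<in>word_pairs k. c powr s * \<theta> ^ k * empirical_weight v w)"
        by (intro sum.cong) (auto simp: word_pairs_def words_def)
      also have "\<dots> = c powr s * \<theta> ^ k * (\<Sum>(v, w)\<in>word_pairs k. empirical_weight v w)"
        by (simp add: sum_distrib_left case_prod_unfold)
      also have "\<dots> \<le> c powr s * \<theta> ^ k * real (k + 1) ^ (N + M + 1)"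
        using sum_empirical_weight_le[OF \<open>0 < k\<close>] \<theta> by (intro mult_left_mono) auto
      finally show "sum ?g (word_pairs k) \<le> c powr s * (\<theta> ^ k * real (k + 1) ^ (N + M + 1))"
        by (simp only: mult.assoc)
    qed
    also have "\<dots> \<le> \<eta>" by (rule n\<^sub>1) (simp add: n\<^sub>0_def)
    finally show ?thesis .
  qed
  then show "\<exists>C. \<Lambda> \<subseteq> (\<Union>vw\<in>C. case vw of (v, w) \<Rightarrow> approx_square \<Lambda> v w) \<and>
      (\<forall>vw\<in>C. bounded (case vw of (v, w) \<Rightarrow> approx_square \<Lambda> v w) \<and>
        diameter (case vw of (v, w) \<Rightarrow> approx_square \<Lambda> v w) \<le> \<delta>) \<and>
      (\<forall>F. finite F \<longrightarrow> F \<subseteq> C \<longrightarrow>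
        (\<Sum>vw\<in>F. diam_pow (\<alpha> + 2 * \<epsilon>) (case vw of (v, w) \<Rightarrow> approx_square \<Lambda> v w)) \<le> \<eta>)"
    unfolding s_def[symmetric]
  proof (intro exI[of _ C] conjI ballI allI impI)
    show "\<Lambda> \<subseteq> (\<Union>vw\<in>C. case vw of (v, w) \<Rightarrow> approx_square \<Lambda> v w)"
      using cover by blast
  qed (use small in \<open>auto simp: case_prod_unfold\<close>)
qed

end

theorem theorem3p1:
  fixes N M :: nat and Ns :: "nat \<Rightarrow> nat"
    and a b d :: "nat \<Rightarrow> real" and t :: "nat \<Rightarrow> real^2"
    and r u :: "nat \<Rightarrow> real" and \<Lambda> :: "(real^2) set"
  assumes "shifted_TGL N M Ns a b d t r u"
    and "is_attractor {1..N} (tgl_map a b d t) \<Lambda>"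
  shows "hausdorff_dim \<Lambda> \<le> alpha_star N M Ns a b \<and>
    (\<exists>p\<in>pos_prob_vectors N. ereal (dim_functional N M Ns a b p) = alpha_star N M Ns a b)"
proof -
  interpret shifted_TGL N M Ns a b d t r u by fact
  let ?D = "dim_functional N M Ns a b"
  obtain p where p: "p \<in> prob_vectors N" and max: "\<And>p'. p' \<in> prob_vectors N \<Longrightarrow> ?D p' \<le> ?D p"
    using dim_functional_attains_max by blast
  have \<alpha>: "alpha_star N M Ns a b = ereal (?D p)"
    unfolding alpha_star_def using p max by (intro antisym SUP_least SUP_upper) auto
  \<comment> \<open>At a point mass both entropies vanish, so the functional is \<open>0\<close> there.\<close>
  have "0 \<le> ?D p"
  proof -
    define e where "e i = (if i = 1 then 1 else 0 :: real)" for i :: nat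
    have "column_probs Ns e m \<in> {0, 1}" for m
      by (simp add: column_probs_def e_def finite_column sum.delta)
    then have "column_probs Ns e m * ln (column_probs Ns e m) = 0" for m
      by (metis insertE ln_one mult_eq_0_iff singletonD)
    then have "(\<Sum>m=1..M. column_probs Ns e m * ln (column_probs Ns e m)) = 0"
      by (intro sum.neutral ballI)
    moreover have "(\<Sum>i=1..N. e i * ln (e i)) = 0"
      by (intro sum.neutral ballI) (simp add: e_def)
    moreover have "0 \<le> e i" for i by (simp add: e_def)
    ultimately have "?D e = 0"
      by (subst dim_functional_eq) (simp_all del: One_nat_def)
    moreover have "e \<in> prob_vectors N"
      using N_pos by (auto simp: prob_vectors_def e_def)
    ultimately show ?thesis using max by metis
  qed
  have "hausdorff_dim \<Lambda> \<le> ereal (?D p)"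
  proof (rule ereal_le_epsilon2)
    fix e :: real assume "0 < e"
    then have "hausdorff_measure (?D p + 2 * (e / 2)) \<Lambda> = 0"
      using max \<open>0 \<le> ?D p\<close> by (intro hausdorff_measure_attractor_0 assms(2)) auto
    then have "hausdorff_dim \<Lambda> \<le> ereal (?D p + e)"
      unfolding hausdorff_dim_def using \<open>0 \<le> ?D p\<close> \<open>0 < e\<close> by (intro INF_lower) auto
    then show "hausdorff_dim \<Lambda> \<le> ereal (?D p) + ereal e" by simp
  qed
  moreover have "p \<in> pos_prob_vectors N"
    using p maximizer_pos[OF p _ max] by (simp add: pos_prob_vectors_def)
  ultimately show ?thesis using \<alpha> by auto
qed

end
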